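(* Consider the half-duplex single-relay fading channel (one source, one relay, one destination) described in the context. For a multiplexing gain $0\le r\le 1$, let $d^*(r)$ denote the optimal diversity gain over the class of all single-relay amplify-and-forward (AF) protocols, i.e. the supremum of the diversity gains achievable at multiplexing gain $r$ by any AF protocol (any choice of $l,l',A_1,A_2,B$ allowed in the context). Then $$d^*(r)\le (1-r)+(1-2r)^+ ,$$ where $(x)^+=\max\{x,0\}$.
   Context: Channel. All channels are flat, Rayleigh-fading and quasi-static: the channel gains $g_1$ (source-destination), $g_2$ (relay-destination) and $h$ (source-relay) are mutually independent zero-mean unit-variance circularly-symmetric complex Gaussian random variables, constant over a codeword (which spans a whole coherence interval). Noises are zero-mean, mutually independent, circularly-symmetric white complex Gaussian, of variance $\sigma_w^2$ at the relay and $\sigma_v^2$ at the destination, with $\sigma_v^2/\sigma_w^2$ a fixed constant. Each node has one antenna and may use average energy at most $E$ per transmitted symbol; $\rho=E/\sigma_v^2$ is the signal-to-noise ratio (SNR). Channel gains are known only at receiving nodes (the relay knows $h$; the destination knows all gains and the protocol parameters); there is no feedback to transmitters. Half-duplex: a node cannot transmit and receive at the same time. Single-relay AF protocol. The relay may only process its observations linearly. Such a protocol with codeword length $l$ is described by an integer $l'\le l$ and matrices $A_1\in\mathbb{C}^{l'\times l'}$, $A_2\in\mathbb{C}^{(l-l')\times(l-l')}$ (both diagonal) and $B\in\mathbb{C}^{(l-l')\times l'}$, through $$\mathbf{y}=\begin{bmatrix} g_1A_1&0\\ g_2hBA_1& g_1A_2\end{bmatrix}\mathbf{x}+\begin{bmatrix}0\\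 g_2B\end{bmatrix}\mathbf{w}+\mathbf{v},$$ where $\mathbf{x}\in\mathbb{C}^l$ is the vector of source symbols (average energy constraint $E$ per symbol, also after multiplication by $A_1,A_2$), $\mathbf{w}\in\mathbb{C}^{l'}$ the relay noise, $\mathbf{v}\in\mathbb{C}^l$ the destination noise, and $\mathbf{y}\in\mathbb{C}^l$ the destination observation. The relay listens during the first $l'$ symbols and, during the remaining $l-l'$ symbols, transmits linear combinations of its observations with coefficients $B=[b_{ji}]$, subject to the average energy constraint, which for independent source symbols of energy $E$ and $A_1=\mathrm{diag}(a_1,\dots,a_{l'})$ reads $$|h|^2E\sum_{i=1}^{l'}|b_{ji}|^2|a_i|^2+\sigma_w^2\sum_{i=1}^{l'}|b_{ji}|^2\le E,\quad j=1,\dots,l-l'.$$ Diversity and multiplexing. For a family of codes indexed by $\rho$, with rate $R(\rho)$ bits per channel use and maximum-likelihood (ML) error probability $P_E(\rho)$ at the destination (averaged over the fading), the multiplexing gain is $r=\lim_{\rho\to\infty}R(\rho)/\log\rho$ and the diversity gain is $d=-\lim_{\rho\to\infty}\log P_E(\rho)/\log\rho$. *)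

theory Defs
  imports "HOL-Probability.Probability"
begin

text \<open>
  All vectors are functions on \<open>nat\<close> of which only the entries below the relevant dimension
  matter; indices start at 0.
\<close>

definition cgauss_density :: "real \<Rightarrow> complex \<Rightarrow> real" where
  "cgauss_density s z = exp (- (cmod z)\<^sup>2 / s) / (pi * s)"

text \<open>
  Zero-mean circularly-symmetric complex Gaussian of variance \<open>s > 0\<close>, i.e. variance \<open>s / 2\<close> for
  each of the real and the imaginary part.
\<close>

definition complex_gaussian :: "real \<Rightarrow> complex measure" where
  "complex_gaussian s = density lborel (\<lambda>z. ennreal (cgauss_density s z))"

text \<open>
  The parameters of an AF protocol at one value of the SNR. The diagonal matrices \<open>A\<^sub>1\<close>, \<open>A\<^sub>2\<close> are
  given by their diagonals. The relay knows the source-relay gain \<open>h\<close>, so the matrix \<open>B\<close> is a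
  function of \<open>h\<close>: \<open>relay_mat P h j i\<close> is \<open>b\<^sub>j\<^sub>i\<close>. The source knows no gain, so \<open>A\<^sub>1\<close> and \<open>A\<^sub>2\<close> are
  constants.
\<close>

record af_protocol =
  cw_len :: nat  \<comment> \<open>\<open>l\<close>\<close>
  listen_len :: nat  \<comment> \<open>\<open>l'\<close>\<close>
  src_diag1 :: "nat \<Rightarrow> complex"
  src_diag2 :: "nat \<Rightarrow> complex"
  relay_mat :: "complex \<Rightarrow> nat \<Rightarrow> nat \<Rightarrow> complex"

text \<open>
  The relay energy condition is the one for independent source symbols of energy \<open>E\<close>;
  \<open>sw\<close> is the variance of the relay noise.
\<close>

definition af_protocol_ok :: "real \<Rightarrow> real \<Rightarrow> af_protocol \<Rightarrow> bool" where
  "af_protocol_ok E sw P \<longleftrightarrow>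
     0 < cw_len P \<and> listen_len P \<le> cw_len P \<and>
     (\<forall>j < cw_len P - listen_len P. \<forall>i < listen_len P.
        (\<lambda>h. relay_mat P h j i) \<in> borel_measurable borel) \<and>
     (\<forall>h. \<forall>j < cw_len P - listen_len P.
        (cmod h)\<^sup>2 * E * (\<Sum>i<listen_len P. (cmod (relay_mat P h j i))\<^sup>2 * (cmod (src_diag1 P i))\<^sup>2)
        + sw * (\<Sum>i<listen_len P. (cmod (relay_mat P h j i))\<^sup>2) \<le> E)"

definition src_symbol :: "af_protocol \<Rightarrow> (nat \<Rightarrow> complex) \<Rightarrow> nat \<Rightarrow> complex" where
  "src_symbol P x i =
     (if i < listen_len P then src_diag1 P i else src_diag2 P (i - listen_len P)) * x i"

text \<open>
  The gains are \<open>(g\<^sub>1, g\<^sub>2, h)\<close>: source-destination, relay-destination, source-relay.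
  \<open>pre_output\<close> is the observation at the destination without the destination noise.
\<close>

fun pre_output ::
  "af_protocol \<Rightarrow> complex \<times> complex \<times> complex \<Rightarrow> (nat \<Rightarrow> complex) \<Rightarrow> (nat \<Rightarrow> complex) \<Rightarrow> nat \<Rightarrow> complex"
where
  "pre_output P (g1, g2, h) x w i =
     (if i < listen_len P then g1 * src_symbol P x i
      else g2 * h * (\<Sum>k<listen_len P. relay_mat P h (i - listen_len P) k * src_symbol P x k)
           + g1 * src_symbol P x i
           + g2 * (\<Sum>k<listen_len P. relay_mat P h (i - listen_len P) k * w k))"

definition channel_output ::
  "af_protocol \<Rightarrow> complex \<times> complex \<times> complex \<Rightarrow> (nat \<Rightarrow> complex) \<Rightarrow>
   (nat \<Rightarrow> complex) \<times> (nat \<Rightarrow> complex) \<Rightarrow> nat \<Rightarrow> complex"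
where
  "channel_output P g x n i = pre_output P g x (fst n) i + snd n i"

definition relay_noise :: "real \<Rightarrow> af_protocol \<Rightarrow> (nat \<Rightarrow> complex) measure" where
  "relay_noise sw P = PiM {..<listen_len P} (\<lambda>_. complex_gaussian sw)"

definition dest_noise :: "real \<Rightarrow> af_protocol \<Rightarrow> (nat \<Rightarrow> complex) measure" where
  "dest_noise sv P = PiM {..<cw_len P} (\<lambda>_. complex_gaussian sv)"

definition fading :: "(complex \<times> complex \<times> complex) measure" where
  "fading = complex_gaussian 1 \<Otimes>\<^sub>M (complex_gaussian 1 \<Otimes>\<^sub>M complex_gaussian 1)"

text \<open>
  The conditional density of the observation \<open>y\<close> given the codeword \<open>x\<close> and the gains \<open>g\<close>.
  Conditioned also on the relay noise \<open>w\<close> the entries of \<open>y\<close> are independent Gaussians, so this is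
  the product of their densities averaged over \<open>w\<close>.
\<close>

definition likelihood ::
  "real \<Rightarrow> real \<Rightarrow> af_protocol \<Rightarrow> complex \<times> complex \<times> complex \<Rightarrow>
   (nat \<Rightarrow> complex) \<Rightarrow> (nat \<Rightarrow> complex) \<Rightarrow> real"
where
  "likelihood sv sw P g x y =
     (\<integral>w. (\<Prod>i<cw_len P. cgauss_density sv (y i - pre_output P g x w i)) \<partial>relay_noise sw P)"

text \<open>Codewords are indexed by the messages \<open>0, \<dots>, code_size C - 1\<close>.\<close>

record codebook =
  code_size :: nat
  codeword :: "nat \<Rightarrow> nat \<Rightarrow> complex"

text \<open>
  The energy is averaged over the codebook and over the symbols of a codeword. A code with
  a single codeword, which never incurs an error, is excluded.
\<close>

definition codebook_ok :: "real \<Rightarrow> af_protocol \<Rightarrow> codebook \<Rightarrow> bool" where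
  "codebook_ok E P C \<longleftrightarrow>
     2 \<le> code_size C \<and>
     (\<Sum>m<code_size C. \<Sum>i<cw_len P. (cmod (codeword C m i))\<^sup>2)
       / (real (code_size C) * real (cw_len P)) \<le> E \<and>
     (\<Sum>m<code_size C. \<Sum>i<cw_len P. (cmod (src_symbol P (codeword C m) i))\<^sup>2)
       / (real (code_size C) * real (cw_len P)) \<le> E"

definition code_rate :: "af_protocol \<Rightarrow> codebook \<Rightarrow> real" where
  "code_rate P C = log 2 (real (code_size C)) / real (cw_len P)"

text \<open>
  Ties are resolved in favour of the smallest message; the average error probability does
  not depend on this choice.
\<close>

definition ml_decode ::
  "real \<Rightarrow> real \<Rightarrow> af_protocol \<Rightarrow> codebook \<Rightarrow> complex \<times> complex \<times> complex \<Rightarrow> (nat \<Rightarrow> complex) \<Rightarrow> nat"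
where
  "ml_decode sv sw P C g y =
     (LEAST m. m < code_size C \<and>
        (\<forall>m' < code_size C.
           likelihood sv sw P g (codeword C m') y \<le> likelihood sv sw P g (codeword C m) y))"

text \<open>Messages are equiprobable; fading, relay noise and destination noise are independent.\<close>

definition ml_error_prob :: "real \<Rightarrow> real \<Rightarrow> af_protocol \<Rightarrow> codebook \<Rightarrow> real" where
  "ml_error_prob sv sw P C =
     (let N = fading \<Otimes>\<^sub>M (relay_noise sw P \<Otimes>\<^sub>M dest_noise sv P) in
      (\<Sum>m<code_size C.
         measure N {\<omega> \<in> space N.
           ml_decode sv sw P C (fst \<omega>)
             (channel_output P (fst \<omega>) (codeword C m) (snd \<omega>)) \<noteq> m})
      / real (code_size C))"

text \<open>
  The symbol energy \<open>E\<close> and the noise variances \<open>sv\<close> (destination) and \<open>sw\<close> (relay) as functions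
  of the SNR.
\<close>

definition snr_scaling :: "(real \<Rightarrow> real) \<Rightarrow> (real \<Rightarrow> real) \<Rightarrow> (real \<Rightarrow> real) \<Rightarrow> bool" where
  "snr_scaling E sv sw \<longleftrightarrow>
     (\<forall>\<rho>>0. 0 < sv \<rho> \<and> 0 < sw \<rho> \<and> E \<rho> / sv \<rho> = \<rho>) \<and>
     (\<exists>c. \<forall>\<rho>>0. sv \<rho> / sw \<rho> = c)"

text \<open>
  The codeword length (which is the coherence interval) and the listening time do not depend on
  the SNR; the matrices and the code may.
\<close>

definition af_family ::
  "(real \<Rightarrow> real) \<Rightarrow> (real \<Rightarrow> real) \<Rightarrow> (real \<Rightarrow> af_protocol) \<Rightarrow> (real \<Rightarrow> codebook) \<Rightarrow> bool"
where
  "af_family E sw P C \<longleftrightarrow>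
     (\<exists>l l'. \<forall>\<rho>>0. cw_len (P \<rho>) = l \<and> listen_len (P \<rho>) = l' \<and>
        af_protocol_ok (E \<rho>) (sw \<rho>) (P \<rho>) \<and> codebook_ok (E \<rho>) (P \<rho>) (C \<rho>))"

definition has_multiplexing_gain ::
  "(real \<Rightarrow> af_protocol) \<Rightarrow> (real \<Rightarrow> codebook) \<Rightarrow> real \<Rightarrow> bool"
where
  "has_multiplexing_gain P C r \<longleftrightarrow>
     ((\<lambda>\<rho>. code_rate (P \<rho>) (C \<rho>) / log 2 \<rho>) \<longlongrightarrow> r) at_top"

text \<open>
  The error probability of a code with at least two codewords is positive, so the value of
  \<open>ln 0\<close> plays no role. The limit is taken in the extended reals, so that an infinite diversity
  gain is not excluded by definition.
\<close>

definition has_diversity_gain ::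
  "(real \<Rightarrow> real) \<Rightarrow> (real \<Rightarrow> real) \<Rightarrow> (real \<Rightarrow> af_protocol) \<Rightarrow> (real \<Rightarrow> codebook) \<Rightarrow> ereal \<Rightarrow> bool"
where
  "has_diversity_gain sv sw P C d \<longleftrightarrow>
     ((\<lambda>\<rho>. ereal (- (ln (ml_error_prob (sv \<rho>) (sw \<rho>) (P \<rho>) (C \<rho>)) / ln \<rho>))) \<longlongrightarrow> d) at_top"

definition optimal_diversity ::
  "(real \<Rightarrow> real) \<Rightarrow> (real \<Rightarrow> real) \<Rightarrow> (real \<Rightarrow> real) \<Rightarrow> real \<Rightarrow> ereal"
where
  "optimal_diversity E sv sw r =
     Sup {d. \<exists>P C. af_family E sw P C \<and> has_multiplexing_gain P C r \<and>
                   has_diversity_gain sv sw P C d}"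

end

theory Submission
  imports Defs
begin

text \<open>
  Let \<open>s < r\<close> and \<open>\<gamma> = \<rho>\<^bsup>s/2\<^esup>\<close>. The event \<open>|g\<^sub>1|\<^sup>2 \<le> \<rho>\<^bsup>-(1-s)\<^esup>\<close>, \<open>|g\<^sub>2|\<^sup>2 \<le> \<rho>\<^bsup>-max (1-2s) 0\<^esup>\<close> has probability of
  order \<open>\<rho>\<^bsup>-(1-s) - max (1-2s) 0\<^esup>\<close>, and on it the direct link has amplitude at most \<open>\<gamma>\<close> and the link
  through the relay at most \<open>\<gamma>\<^sup>2\<close>, relative to the noise. It remains to see that on this event the
  conditional error probability is bounded below by a constant. Knowing the relay noise and \<open>h\<close> does
  not help: the noiseless outputs of the codewords of energy \<open>O(lE)\<close>, which are most of the codewords,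
  fall into \<open>O(\<gamma>\<^bsup>2l\<^esup>) = O(\<rho>\<^bsup>ls\<^esup>)\<close> cells of the size of the destination noise, whereas there are about
  \<open>\<rho>\<^bsup>lr\<^esup>\<close> codewords. The output densities of the codewords of a cell all dominate a
  constant multiple of one density, under which a decoder outputs at most one codeword; hence the
  error probabilities over a cell with \<open>n\<close> codewords add up to at least a constant times \<open>n - 1\<close>.
  For \<open>r = 0\<close> there is a single cell. Finally \<open>s \<rightarrow> r\<close>.
\<close>

subsection \<open>Products of complex Gaussians\<close>

text \<open>The density factors over real and imaginary part into two centred normal densities of
  variance s/2.\<close>

lemma nn_integral_cgauss:
  assumes s: "0 < s"
  shows "(\<integral>\<^sup>+z. ennreal (cgauss_density s z) \<partial>lborel) = 1"
proof -
  define N where "N = (\<lambda>x. normal_density 0 (sqrt (s / 2)) x)"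
  have eq: "ennreal (cgauss_density s z) = (\<Prod>b\<in>Basis. ennreal (N (z \<bullet> b)))" for z :: complex
    using s by (simp add: Basis_complex_def N_def normal_density_def cgauss_density_def inner_complex_def
        cmod_power2 ennreal_mult[symmetric] exp_add[symmetric] add_divide_distrib diff_divide_distrib)
  have "(\<integral>\<^sup>+x. ennreal (N x) \<partial>lborel) = 1"
    using s by (simp add: N_def nn_integral_eq_integral)
  then show ?thesis
    unfolding eq by (subst nn_integral_lborel_prod) (simp_all add: N_def Basis_complex_def)
qed

lemma cgauss_density_measurable [measurable]: "cgauss_density s \<in> borel_measurable borel"
  unfolding cgauss_density_def[abs_def] by measurable

lemma cgauss_density_nonneg: "0 < s \<Longrightarrow> 0 \<le> cgauss_density s z"
  by (simp add: cgauss_density_def)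

lemma space_complex_gaussian [simp]: "space (complex_gaussian s) = UNIV"
  by (simp add: complex_gaussian_def)

lemma sets_complex_gaussian [measurable_cong, simp]: "sets (complex_gaussian s) = sets borel"
  by (simp add: complex_gaussian_def)

lemma prob_space_complex_gaussian: "0 < s \<Longrightarrow> prob_space (complex_gaussian s)"
  by (rule prob_spaceI)
     (simp add: complex_gaussian_def emeasure_density nn_integral_cgauss cong: nn_integral_cong)

lemma prob_space_cgauss_PiM: "0 < s \<Longrightarrow> prob_space (PiM I (\<lambda>_. complex_gaussian s))"
  by (intro prob_space_PiM prob_space_complex_gaussian)

lemma distr_complex_gaussian_shift:
  assumes "0 < s"
  shows "distr (complex_gaussian s) borel ((+) \<mu>) = density lborel (\<lambda>z. cgauss_density s (z - \<mu>))"
proof -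
  have "density (lborel :: complex measure) (\<lambda>z. cgauss_density s (z - \<mu>)) =
      density (distr lborel borel ((+) \<mu>)) (\<lambda>z. cgauss_density s (z - \<mu>))"
    by (simp add: lborel_distr_plus)
  also have "\<dots> = distr (density lborel (\<lambda>z. cgauss_density s (\<mu> + z - \<mu>))) borel ((+) \<mu>)"
    by (subst density_distr) auto
  finally show ?thesis by (simp add: complex_gaussian_def)
qed

lemma PiM_density:
  fixes f :: "'i \<Rightarrow> 'a::euclidean_space \<Rightarrow> ennreal"
  assumes "finite I" and f [measurable]: "\<And>i. i \<in> I \<Longrightarrow> f i \<in> borel_measurable borel"
  assumes p: "\<And>i. i \<in> I \<Longrightarrow> prob_space (density lborel (f i))"
  shows "density (PiM I (\<lambda>_. lborel)) (\<lambda>y. \<Prod>i\<in>I. f i (y i)) = PiM I (\<lambda>i. density lborel (f i))"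
proof -
  interpret L: product_sigma_finite "\<lambda>_. lborel :: 'a measure"
    by (rule product_sigma_finite.intro) (rule sigma_finite_lborel)
  \<comment> \<open>The hypotheses cover only the indices in \<open>I\<close>, while
    \<open>product_sigma_finite\<close> asks for a sigma-finite measure at every index;
    \<open>lborel\<close> fills the rest.\<close>
  define N where "N i = (if i \<in> I then density lborel (f i) else lborel)" for i
  interpret N: product_sigma_finite N
  proof (rule product_sigma_finite.intro)
    fix i show "sigma_finite_measure (N i)"
      unfolding N_def using p prob_space_imp_sigma_finite by (auto intro: sigma_finite_lborel)
  qed
  have "density (PiM I (\<lambda>_. lborel)) (\<lambda>y. \<Prod>i\<in>I. f i (y i)) = PiM I N"
  proof (rule N.PiM_eqI)
    show "sets (density (Pi\<^sub>M I (\<lambda>_. lborel)) (\<lambda>y. \<Prod>i\<in>I. f i (y i))) = sets (Pi\<^sub>M I N)"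
      by (simp add: N_def cong: sets_PiM_cong)
    fix A assume "\<And>i. i \<in> I \<Longrightarrow> A i \<in> sets (N i)"
    then have A [measurable]: "\<And>i. i \<in> I \<Longrightarrow> A i \<in> sets borel" by (simp add: N_def)
    have "emeasure (density (Pi\<^sub>M I (\<lambda>_. lborel)) (\<lambda>y. \<Prod>i\<in>I. f i (y i))) (Pi\<^sub>E I A) =
        (\<integral>\<^sup>+y. (\<Prod>i\<in>I. f i (y i)) * indicator (Pi\<^sub>E I A) y \<partial>(Pi\<^sub>M I (\<lambda>_. lborel)))"
      using \<open>finite I\<close> by (subst emeasure_density) (auto intro!: sets_PiM_I_finite)
    also have "\<dots> = (\<integral>\<^sup>+y. (\<Prod>i\<in>I. f i (y i) * indicator (A i) (y i)) \<partial>(Pi\<^sub>M I (\<lambda>_. lborel)))"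
      using \<open>finite I\<close>
      by (intro nn_integral_cong) (auto simp: prod.distrib indicator_def space_PiM PiE_def Pi_def prod_eq_1_iff
          intro!: prod.neutral)
    also have "\<dots> = (\<Prod>i\<in>I. \<integral>\<^sup>+y. f i y * indicator (A i) y \<partial>lborel)"
      using \<open>finite I\<close> by (intro L.product_nn_integral_prod) auto
    also have "\<dots> = (\<Prod>i\<in>I. emeasure (N i) (A i))"
      by (intro prod.cong) (auto simp: N_def emeasure_density)
    finally show "emeasure (density (Pi\<^sub>M I (\<lambda>_. lborel)) (\<lambda>y. \<Prod>i\<in>I. f i (y i))) (Pi\<^sub>E I A) =
      (\<Prod>i\<in>I. emeasure (N i) (A i))" .
  qed fact
  also have "\<dots> = PiM I (\<lambda>i. density lborel (f i))"
    by (intro PiM_cong) (auto simp: N_def)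
  finally show ?thesis .
qed

text \<open>This is the law of the observation once the gains and the relay noise are fixed:
  \<open>\<mu>\<close> is then the deterministic noiseless output. On boxes it factors into
  one-dimensional shifts.\<close>

lemma distr_PiM_complex_gaussian_shift:
  assumes s: "0 < s" and I: "finite I"
  shows "distr (PiM I (\<lambda>_. complex_gaussian s)) (PiM I (\<lambda>_. borel)) (\<lambda>v. \<lambda>i\<in>I. \<mu> i + v i) =
    density (PiM I (\<lambda>_. lborel)) (\<lambda>y. \<Prod>i\<in>I. ennreal (cgauss_density s (y i - \<mu> i)))"
proof -
  have sh: "prob_space (density lborel (\<lambda>z. cgauss_density s (z - \<mu> i)))" for i
    unfolding distr_complex_gaussian_shift[OF s, symmetric]
    by (intro prob_space.prob_space_distr prob_space_complex_gaussian s) simp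
  interpret G: product_sigma_finite "\<lambda>_. complex_gaussian s"
    by (rule product_sigma_finite.intro, rule prob_space_imp_sigma_finite[OF prob_space_complex_gaussian[OF s]])
  interpret N: product_sigma_finite "\<lambda>i. density lborel (\<lambda>z. cgauss_density s (z - \<mu> i))"
    by (rule product_sigma_finite.intro, rule prob_space_imp_sigma_finite[OF sh])
  have m [measurable]: "(\<lambda>v. \<lambda>i\<in>I. \<mu> i + v i) \<in> PiM I (\<lambda>_. complex_gaussian s) \<rightarrow>\<^sub>M PiM I (\<lambda>_. borel)"
    by measurable
  have "distr (PiM I (\<lambda>_. complex_gaussian s)) (PiM I (\<lambda>_. borel)) (\<lambda>v. \<lambda>i\<in>I. \<mu> i + v i) =
      PiM I (\<lambda>i. density lborel (\<lambda>z. cgauss_density s (z - \<mu> i)))"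
  proof (rule N.PiM_eqI[OF I])
    show "sets (distr (Pi\<^sub>M I (\<lambda>_. complex_gaussian s)) (Pi\<^sub>M I (\<lambda>_. borel)) (\<lambda>v. \<lambda>i\<in>I. \<mu> i + v i)) =
      sets (Pi\<^sub>M I (\<lambda>i. density lborel (\<lambda>z. ennreal (cgauss_density s (z - \<mu> i)))))"
      by (simp cong: sets_PiM_cong)
    fix A assume "\<And>i. i \<in> I \<Longrightarrow> A i \<in> sets (density lborel (\<lambda>z. ennreal (cgauss_density s (z - \<mu> i))))"
    then have A [measurable]: "\<And>i. i \<in> I \<Longrightarrow> A i \<in> sets borel" by simp
    have "emeasure (distr (Pi\<^sub>M I (\<lambda>_. complex_gaussian s)) (Pi\<^sub>M I (\<lambda>_. borel)) (\<lambda>v. \<lambda>i\<in>I. \<mu> i + v i)) (Pi\<^sub>E I A)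
      = emeasure (PiM I (\<lambda>_. complex_gaussian s)) (Pi\<^sub>E I (\<lambda>i. (+) (\<mu> i) -` A i))"
      using sets_PiM_I_finite[of I A "\<lambda>_. borel"] I
      by (subst emeasure_distr) (auto intro!: arg_cong[where f="emeasure _"] simp: space_PiM PiE_def Pi_def)
    also have "\<dots> = (\<Prod>i\<in>I. emeasure (complex_gaussian s) ((+) (\<mu> i) -` A i))"
      using I A measurable_sets_borel[where f="(+) (\<mu> _)"] by (intro G.emeasure_PiM) auto
    also have "\<dots> = (\<Prod>i\<in>I. emeasure (distr (complex_gaussian s) borel ((+) (\<mu> i))) (A i))"
      by (intro prod.cong refl) (simp add: emeasure_distr)
    finally show "emeasure (distr (Pi\<^sub>M I (\<lambda>_. complex_gaussian s)) (Pi\<^sub>M I (\<lambda>_. borel)) (\<lambda>v. \<lambda>i\<in>I. \<mu> i + v i)) (Pi\<^sub>E I A) =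
      (\<Prod>i\<in>I. emeasure (density lborel (\<lambda>z. cgauss_density s (z - \<mu> i))) (A i))"
      by (simp add: distr_complex_gaussian_shift[OF s])
  qed
  also have "\<dots> = density (PiM I (\<lambda>_. lborel)) (\<lambda>y. \<Prod>i\<in>I. ennreal (cgauss_density s (y i - \<mu> i)))"
    using I sh by (intro PiM_density[symmetric]) auto
  finally show ?thesis .
qed

text \<open>Halving the variance absorbs a displacement of the mean at the cost of a constant factor
  that does not depend on \<open>y\<close>.\<close>

lemma cgauss_density_ge_half_variance:
  assumes s: "0 < s" and d: "(cmod (\<mu> - c))\<^sup>2 \<le> D * s"
  shows "exp (- 2 * D) / 2 * cgauss_density (s / 2) (y - c) \<le> cgauss_density s (y - \<mu>)"
proof -
  have "cmod (y - \<mu>) \<le> cmod (y - c) + cmod (\<mu> - c)"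
    by (metis add.commute diff_add_cancel diff_diff_eq2 norm_triangle_ineq4)
  then have "(cmod (y - \<mu>))\<^sup>2 \<le> (cmod (y - c) + cmod (\<mu> - c))\<^sup>2"
    by (rule power_mono) simp
  \<comment> \<open>The factor 2 before the first square is what halving the variance pays for; the
    second square ends up in exp (- 2 D). The factor 1/2 in the claim is the ratio of the
    normalising constants for s and s/2.\<close>
  also have "\<dots> \<le> 2 * (cmod (y - c))\<^sup>2 + 2 * (cmod (\<mu> - c))\<^sup>2"
    using sum_squares_bound[of "cmod (y - c)" "cmod (\<mu> - c)"] by (simp add: power2_sum)
  also have "\<dots> \<le> 2 * (cmod (y - c))\<^sup>2 + 2 * (D * s)" using d by simp
  finally have "(cmod (y - \<mu>))\<^sup>2 / s \<le> 2 * (cmod (y - c))\<^sup>2 / s + 2 * D"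
    using s by (simp add: field_simps)
  then have "exp (- (2 * D) - 2 * (cmod (y - c))\<^sup>2 / s) \<le> exp (- (cmod (y - \<mu>))\<^sup>2 / s)" by simp
  then have "exp (- (2 * D)) * exp (- (2 * (cmod (y - c))\<^sup>2 / s)) / (pi * s) \<le> exp (- (cmod (y - \<mu>))\<^sup>2 / s) / (pi * s)"
    using s by (intro divide_right_mono) (auto simp: exp_add[symmetric])
  then show ?thesis using s by (simp add: cgauss_density_def mult.commute)
qed

text \<open>On the unit disc the density is at least exp (- 1) / pi, and the disc of squared radius
  s has area pi s.\<close>

lemma complex_gaussian_ball_ge:
  assumes "0 \<le> s" "s \<le> 1"
  shows "s * exp (- 1) \<le> measure (complex_gaussian 1) {z. (cmod z)\<^sup>2 \<le> s}"
proof -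
  interpret prob_space "complex_gaussian 1" by (rule prob_space_complex_gaussian) simp
  have ball: "{z. (cmod z)\<^sup>2 \<le> s} = cball 0 (sqrt s)"
    using assms by (auto simp: real_le_rsqrt sqrt_ge_absD) 
  have "ennreal (s * exp (- 1)) = ennreal (exp (- 1) / pi) * emeasure lborel (cball (0::complex) (sqrt s))"
    using assms by (simp add: emeasure_cball unit_ball_vol_2 ennreal_mult[symmetric])
  also have "\<dots> = (\<integral>\<^sup>+z\<in>cball (0::complex) (sqrt s). ennreal (exp (- 1) / pi) \<partial>lborel)"
    by (simp add: nn_integral_cmult_indicator)
  also have "\<dots> \<le> (\<integral>\<^sup>+z\<in>cball (0::complex) (sqrt s). ennreal (cgauss_density 1 z) \<partial>lborel)"
  proof (rule nn_integral_mono)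
    fix z :: complex
    have "exp (- 1) / pi \<le> cgauss_density 1 z" if "z \<in> cball 0 (sqrt s)"
    proof -
      have "(cmod z)\<^sup>2 \<le> 1" using that ball assms by (metis mem_Collect_eq order_trans)
      then show ?thesis by (simp add: cgauss_density_def divide_right_mono)
    qed
    then show "ennreal (exp (- 1) / pi) * indicator (cball 0 (sqrt s)) z \<le>
        ennreal (cgauss_density 1 z) * indicator (cball 0 (sqrt s)) z"
      by (auto simp: indicator_def intro: ennreal_leI)
  qed
  also have "\<dots> = emeasure (complex_gaussian 1) {z. (cmod z)\<^sup>2 \<le> s}"
    unfolding ball by (simp add: complex_gaussian_def emeasure_density)
  finally show ?thesis by (simp add: emeasure_eq_measure)
qed

subsection \<open>Lower bounds on the probability of error\<close>

text \<open>The common lower density is the Gaussian law \<open>Q\<close> of variance s/2 around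
  \<open>c\<close>: by \<open>cgauss_density_ge_half_variance\<close>, each coordinate costs a
  factor exp (- 2 D) / 2. Under \<open>Q\<close> the events of deciding for the different messages
  are disjoint, so their probabilities add up to at most 1. The decoder is arbitrary.\<close>

lemma cell_error_ge:
  fixes \<mu> :: "nat \<Rightarrow> 'i \<Rightarrow> complex" and dec :: "('i \<Rightarrow> complex) \<Rightarrow> nat"
  assumes s: "0 < s" and I: "finite I" and S: "finite S"
    and dec [measurable]: "dec \<in> PiM I (\<lambda>_. borel) \<rightarrow>\<^sub>M count_space UNIV"
    and near: "\<And>m i. m \<in> S \<Longrightarrow> i \<in> I \<Longrightarrow> (cmod (\<mu> m i - c i))\<^sup>2 \<le> D * s"
  defines "G \<equiv> PiM I (\<lambda>_. complex_gaussian s)"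
  shows "(exp (- 2 * D) / 2) ^ card I * (real (card S) - 1) \<le>
    (\<Sum>m\<in>S. measure G {v \<in> space G. dec (\<lambda>i\<in>I. \<mu> m i + v i) \<noteq> m})"
proof -
  define \<kappa> where "\<kappa> = (exp (- 2 * D) / 2) ^ card I"
  define L where "L = PiM I (\<lambda>_. lborel :: complex measure)"
  define Q where "Q = density L (\<lambda>y. \<Prod>i\<in>I. ennreal (cgauss_density (s / 2) (y i - c i)))"
  have setsL [measurable_cong]: "sets L = sets (PiM I (\<lambda>_. borel))"
    unfolding L_def by (intro sets_PiM_cong) auto
  have Q_distr: "Q = distr (PiM I (\<lambda>_. complex_gaussian (s / 2))) (PiM I (\<lambda>_. borel)) (\<lambda>v. \<lambda>i\<in>I. c i + v i)"
    using s I unfolding Q_def L_def by (intro distr_PiM_complex_gaussian_shift[symmetric]) auto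
  interpret Q: prob_space Q
    unfolding Q_distr using s by (intro prob_space.prob_space_distr prob_space_cgauss_PiM) (auto simp: measurable_restrict)
  interpret G: prob_space G
    unfolding G_def by (rule prob_space_cgauss_PiM[OF s])
  have setsQ [measurable_cong]: "sets Q = sets (PiM I (\<lambda>_. borel))" by (simp add: Q_distr)
  have spQ: "space Q = space (PiM I (\<lambda>_. borel))" by (simp add: Q_distr)
  have \<kappa>: "0 \<le> \<kappa>" by (simp add: \<kappa>_def)
  have "\<kappa> * Q.prob {y \<in> space Q. dec y \<noteq> m} \<le> G.prob {v \<in> space G. dec (\<lambda>i\<in>I. \<mu> m i + v i) \<noteq> m}"
    if m: "m \<in> S" for m
  proof -
    define A where "A = {y \<in> space Q. dec y \<noteq> m}"
    have A [measurable]: "A \<in> sets (PiM I (\<lambda>_. borel))"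
      unfolding A_def setsQ[symmetric] by measurable
    have "ennreal \<kappa> * emeasure Q A =
        (\<integral>\<^sup>+y. ennreal \<kappa> * ((\<Prod>i\<in>I. ennreal (cgauss_density (s / 2) (y i - c i))) * indicator A y) \<partial>L)"
      unfolding Q_def using A by (subst emeasure_density) (auto simp: setsL nn_integral_cmult)
    also have "\<dots> \<le> (\<integral>\<^sup>+y. (\<Prod>i\<in>I. ennreal (cgauss_density s (y i - \<mu> m i))) * indicator A y \<partial>L)"
    proof (rule nn_integral_mono)
      fix y
      have "\<kappa> * (\<Prod>i\<in>I. cgauss_density (s / 2) (y i - c i)) =
          (\<Prod>i\<in>I. exp (- 2 * D) / 2 * cgauss_density (s / 2) (y i - c i))"
        by (simp only: prod.distrib prod_constant \<kappa>_def)
      also have "\<dots> \<le> (\<Prod>i\<in>I. cgauss_density s (y i - \<mu> m i))"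
        using s near m cgauss_density_ge_half_variance[OF s]
        by (intro prod_mono conjI) (auto intro!: mult_nonneg_nonneg cgauss_density_nonneg)
      finally have "ennreal \<kappa> * (\<Prod>i\<in>I. ennreal (cgauss_density (s / 2) (y i - c i))) \<le>
          (\<Prod>i\<in>I. ennreal (cgauss_density s (y i - \<mu> m i)))"
        using s \<kappa> by (simp add: prod_ennreal cgauss_density_nonneg ennreal_mult'[symmetric] prod_nonneg)
      then show "ennreal \<kappa> * ((\<Prod>i\<in>I. ennreal (cgauss_density (s / 2) (y i - c i))) * indicator A y) \<le>
          (\<Prod>i\<in>I. ennreal (cgauss_density s (y i - \<mu> m i))) * indicator A y"
        by (simp add: indicator_def)
    qed
    also have "\<dots> = emeasure (density L (\<lambda>y. \<Prod>i\<in>I. ennreal (cgauss_density s (y i - \<mu> m i)))) A"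
      using A by (subst emeasure_density) (auto simp: setsL)
    also have "\<dots> = emeasure (distr G (PiM I (\<lambda>_. borel)) (\<lambda>v. \<lambda>i\<in>I. \<mu> m i + v i)) A"
      unfolding G_def L_def by (subst distr_PiM_complex_gaussian_shift[OF s I]) simp
    also have "\<dots> = emeasure G ((\<lambda>v. \<lambda>i\<in>I. \<mu> m i + v i) -` A \<inter> space G)"
      by (rule emeasure_distr) (auto simp: G_def)
    also have "(\<lambda>v. \<lambda>i\<in>I. \<mu> m i + v i) -` A \<inter> space G = {v \<in> space G. dec (\<lambda>i\<in>I. \<mu> m i + v i) \<noteq> m}"
      by (auto simp: A_def spQ space_PiM)
    finally show ?thesis
      using \<kappa> by (simp add: A_def Q.emeasure_eq_measure G.emeasure_eq_measure ennreal_mult'[symmetric])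
  qed
  then have le: "(\<Sum>m\<in>S. \<kappa> * Q.prob {y \<in> space Q. dec y \<noteq> m}) \<le>
      (\<Sum>m\<in>S. G.prob {v \<in> space G. dec (\<lambda>i\<in>I. \<mu> m i + v i) \<noteq> m})"
    by (rule sum_mono)
  have meas: "{y \<in> space Q. dec y = m} \<in> Q.events" for m by measurable
  have "Q.prob {y \<in> space Q. dec y \<noteq> m} = 1 - Q.prob {y \<in> space Q. dec y = m}" for m
    by (subst Q.prob_compl[OF meas, symmetric]) (auto intro!: arg_cong[where f=Q.prob])
  then have "(\<Sum>m\<in>S. Q.prob {y \<in> space Q. dec y \<noteq> m}) =
      real (card S) - (\<Sum>m\<in>S. Q.prob {y \<in> space Q. dec y = m})"
    by (simp add: sum_subtractf)
  also have "(\<Sum>m\<in>S. Q.prob {y \<in> space Q. dec y = m}) = Q.prob (\<Union>m\<in>S. {y \<in> space Q. dec y = m})"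
    using S meas by (intro Q.finite_measure_finite_Union[symmetric]) (auto simp: disjoint_family_on_def)
  also have "real (card S) - Q.prob (\<Union>m\<in>S. {y \<in> space Q. dec y = m}) \<ge> real (card S) - 1"
    by simp
  finally have "\<kappa> * (real (card S) - 1) \<le> \<kappa> * (\<Sum>m\<in>S. Q.prob {y \<in> space Q. dec y \<noteq> m})"
    using \<kappa> by (intro mult_left_mono)
  with le show ?thesis by (simp add: sum_distrib_left \<kappa>_def)
qed

text \<open>A cell of \<open>q\<close> with n codewords contributes n - 1 by
  \<open>cell_error_ge\<close>, with any of its members as centre; the subtracted ones add up to the
  number of cells.\<close>

lemma quantised_error_ge:
  fixes \<mu> :: "nat \<Rightarrow> 'i \<Rightarrow> complex" and dec :: "('i \<Rightarrow> complex) \<Rightarrow> nat" and q :: "nat \<Rightarrow> 'q"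
  assumes s: "0 < s" and I: "finite I" and S: "finite S"
    and dec: "dec \<in> PiM I (\<lambda>_. borel) \<rightarrow>\<^sub>M count_space UNIV"
    and near: "\<And>m m' i. m \<in> S \<Longrightarrow> m' \<in> S \<Longrightarrow> q m = q m' \<Longrightarrow> i \<in> I \<Longrightarrow> (cmod (\<mu> m i - \<mu> m' i))\<^sup>2 \<le> D * s"
  defines "G \<equiv> PiM I (\<lambda>_. complex_gaussian s)"
  shows "(exp (- 2 * D) / 2) ^ card I * (real (card S) - real (card (q ` S))) \<le>
    (\<Sum>m\<in>S. measure G {v \<in> space G. dec (\<lambda>i\<in>I. \<mu> m i + v i) \<noteq> m})"
proof -
  define err where "err m = measure G {v \<in> space G. dec (\<lambda>i\<in>I. \<mu> m i + v i) \<noteq> m}" for m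
  define \<kappa> where "\<kappa> = (exp (- 2 * D) / 2) ^ card I"
  have "\<kappa> * (real (card {m\<in>S. q m = z}) - 1) \<le> (\<Sum>m\<in>{m\<in>S. q m = z}. err m)" if "z \<in> q ` S" for z
  proof -
    from that obtain m0 where "m0 \<in> S" "q m0 = z" by auto
    then show ?thesis unfolding \<kappa>_def err_def G_def
      using S near by (intro cell_error_ge[OF s I _ dec, where c = "\<mu> m0"]) auto
  qed
  then have "(\<Sum>z\<in>q ` S. \<kappa> * (real (card {m\<in>S. q m = z}) - 1)) \<le> (\<Sum>z\<in>q ` S. \<Sum>m\<in>{m\<in>S. q m = z}. err m)"
    by (rule sum_mono)
  also have "\<dots> = sum err S" by (rule sum.image_gen[OF S, symmetric])
  also have "(\<Sum>z\<in>q ` S. \<kappa> * (real (card {m\<in>S. q m = z}) - 1)) =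
      \<kappa> * ((\<Sum>z\<in>q ` S. \<Sum>m\<in>{m\<in>S. q m = z}. 1) - real (card (q ` S)))"
    by (simp add: sum_distrib_left[symmetric] sum_subtractf)
  also have "(\<Sum>z\<in>q ` S. \<Sum>m\<in>{m\<in>S. q m = z}. 1 :: real) = real (card S)"
    using sum.image_gen[OF S, of "\<lambda>_. 1 :: real" q] by simp
  finally show ?thesis unfolding \<kappa>_def err_def .
qed

section \<open>Measurability of the decoder and averaging over fading and noise\<close>

text \<open>Projections in place of the pattern (g1, g2, h) allow the gains to be an arbitrary
  measurable function.\<close>

lemma pre_output_eq:
  "pre_output P g x w i =
     (if i < listen_len P then fst g * src_symbol P x i
      else fst (snd g) * snd (snd g) *
             (\<Sum>k<listen_len P. relay_mat P (snd (snd g)) (i - listen_len P) k * src_symbol P x k)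
           + fst g * src_symbol P x i
           + fst (snd g) * (\<Sum>k<listen_len P. relay_mat P (snd (snd g)) (i - listen_len P) k * w k))"
  by (cases g) simp

lemma pre_output_measurable:
  assumes P: "af_protocol_ok E sw P" and i: "i < cw_len P"
    and g [measurable]: "g \<in> M \<rightarrow>\<^sub>M borel \<Otimes>\<^sub>M (borel \<Otimes>\<^sub>M borel)"
    and w [measurable]: "\<And>k. k < listen_len P \<Longrightarrow> (\<lambda>p. w p k) \<in> borel_measurable M"
  shows "(\<lambda>p. pre_output P (g p) x (w p) i) \<in> borel_measurable M"
proof (cases "i < listen_len P")
  case True
  then show ?thesis by (simp add: pre_output_eq)
next
  case False
  have [measurable]: "(\<lambda>p. relay_mat P (snd (snd (g p))) (i - listen_len P) k) \<in> borel_measurable M"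
    if "k < listen_len P" for k
  proof -
    have "(\<lambda>h. relay_mat P h (i - listen_len P) k) \<in> borel_measurable borel"
      using P that i False by (auto simp: af_protocol_ok_def)
    then show ?thesis
      by (rule measurable_compose[rotated]) measurable
  qed
  show ?thesis using False by (simp add: pre_output_eq)
qed

lemma likelihood_measurable:
  assumes P: "af_protocol_ok E sw P" and sw: "0 < sw"
  shows "(\<lambda>p. likelihood sv sw P (fst p) x (snd p)) \<in>
    borel_measurable ((borel \<Otimes>\<^sub>M (borel \<Otimes>\<^sub>M borel)) \<Otimes>\<^sub>M PiM {..<cw_len P} (\<lambda>_. borel))"
proof -
  interpret W: prob_space "relay_noise sw P"
    unfolding relay_noise_def by (rule prob_space_cgauss_PiM[OF sw])
  have [measurable]: "(\<lambda>p. snd p k) \<in> borel_measurable (M \<Otimes>\<^sub>M relay_noise sw P)"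
    if "k < listen_len P" for k and M :: "'a measure"
    unfolding relay_noise_def by measurable (use that in simp)
  have [measurable]: "(\<lambda>p. pre_output P (fst (fst p)) x (snd p) i) \<in> borel_measurable
      (((borel \<Otimes>\<^sub>M (borel \<Otimes>\<^sub>M borel)) \<Otimes>\<^sub>M PiM {..<cw_len P} (\<lambda>_. borel)) \<Otimes>\<^sub>M relay_noise sw P)"
    if "i < cw_len P" for i
    by (rule pre_output_measurable[OF P that]) measurable
  show ?thesis
    unfolding likelihood_def
    by (intro W.borel_measurable_lebesgue_integral) (simp add: case_prod_beta)
qed

lemma ml_decode_measurable:
  assumes P: "af_protocol_ok E sw P" and sw: "0 < sw"
  shows "(\<lambda>p. ml_decode sv sw P C (fst p) (snd p)) \<in>
    (borel \<Otimes>\<^sub>M (borel \<Otimes>\<^sub>M borel)) \<Otimes>\<^sub>M PiM {..<cw_len P} (\<lambda>_. borel) \<rightarrow>\<^sub>M count_space UNIV"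
proof -
  note [measurable] = likelihood_measurable[OF P sw]
  show ?thesis unfolding ml_decode_def by measurable
qed

text \<open>Only entries below \<open>cw_len P\<close> enter the likelihood. Restricting moves the
  channel output into the space of \<open>PiM {..<cw_len P}\<close>, where the decoder is known to
  be measurable.\<close>

lemma ml_decode_restrict:
  "ml_decode sv sw P C g (restrict y {..<cw_len P}) = ml_decode sv sw P C g y"
proof -
  have "likelihood sv sw P g x (restrict y {..<cw_len P}) = likelihood sv sw P g x y" for x
    unfolding likelihood_def by (intro Bochner_Integration.integral_cong prod.cong refl) simp
  then show ?thesis by (simp add: ml_decode_def)
qed

lemma sets_fading [measurable_cong]: "sets fading = sets (borel \<Otimes>\<^sub>M (borel \<Otimes>\<^sub>M borel))"
  unfolding fading_def by (intro sets_pair_measure_cong) auto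

lemma space_fading [simp]: "space fading = UNIV"
  by (simp add: fading_def space_pair_measure)

lemma prob_space_fading: "prob_space fading"
  unfolding fading_def by (intro prob_space_pair prob_space_complex_gaussian) auto

text \<open>Tonelli: with gains in \<open>A\<close> and the relay noise \<open>w\<close> fixed, only
  the destination noise is random. A bound uniform in \<open>w\<close> survives averaging, and gains
  outside \<open>A\<close> contribute nonnegatively. \<open>\<beta>\<close> bounds the sum over the
  messages, hence the division by the code size.\<close>

lemma ml_error_prob_ge:
  assumes P: "af_protocol_ok E sw P" and sw: "0 < sw" and sv: "0 < sv"
    and A: "A \<in> sets fading" and \<beta>: "0 \<le> \<beta>"
    and le: "\<And>g w. g \<in> A \<Longrightarrow> \<beta> \<le> (\<Sum>m<code_size C. measure (dest_noise sv P)
      {v \<in> space (dest_noise sv P).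
         ml_decode sv sw P C g (\<lambda>i\<in>{..<cw_len P}. pre_output P g (codeword C m) w i + v i) \<noteq> m})"
  shows "measure fading A * \<beta> / real (code_size C) \<le> ml_error_prob sv sw P C"
proof -
  define W where "W = relay_noise sw P"
  define V where "V = dest_noise sv P"
  define N where "N = fading \<Otimes>\<^sub>M (W \<Otimes>\<^sub>M V)"
  interpret F: prob_space fading by (rule prob_space_fading)
  interpret W: prob_space W unfolding W_def relay_noise_def by (rule prob_space_cgauss_PiM[OF sw])
  interpret V: prob_space V unfolding V_def dest_noise_def by (rule prob_space_cgauss_PiM[OF sv])
  interpret WV: prob_space "W \<Otimes>\<^sub>M V" by (intro prob_space_pair W.prob_space_axioms V.prob_space_axioms)
  interpret N: prob_space N
    unfolding N_def by (intro prob_space_pair F.prob_space_axioms WV.prob_space_axioms)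
  define out where "out m \<omega> = (\<lambda>i\<in>{..<cw_len P}. pre_output P (fst \<omega>) (codeword C m) (fst (snd \<omega>)) i + snd (snd \<omega>) i)"
    for m \<omega>
  define err where "err m = {\<omega> \<in> space N. ml_decode sv sw P C (fst \<omega>) (out m \<omega>) \<noteq> m}" for m
  have [measurable]: "(\<lambda>\<omega>. pre_output P (fst \<omega>) (codeword C m) (fst (snd \<omega>)) i) \<in> borel_measurable N"
    if "i < cw_len P" for i m
    unfolding N_def W_def relay_noise_def by (rule pre_output_measurable[OF P that]) measurable
  have [measurable]: "(\<lambda>\<omega>. snd (snd \<omega>) i) \<in> borel_measurable N" if "i < cw_len P" for i
    unfolding N_def V_def dest_noise_def by measurable (use that in simp)
  have [measurable]: "out m \<in> N \<rightarrow>\<^sub>M PiM {..<cw_len P} (\<lambda>_. borel)" for m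
    unfolding out_def by (intro measurable_restrict) auto
  have [measurable]: "fst \<in> N \<rightarrow>\<^sub>M borel \<Otimes>\<^sub>M (borel \<Otimes>\<^sub>M borel)"
    unfolding N_def by measurable
  have [measurable]: "(\<lambda>\<omega>. ml_decode sv sw P C (fst \<omega>) (out m \<omega>)) \<in> N \<rightarrow>\<^sub>M count_space UNIV" for m
    using measurable_compose[OF measurable_Pair ml_decode_measurable[OF P sw], of fst N "out m"] by simp
  have err_meas [measurable]: "err m \<in> sets N" for m
    unfolding err_def by measurable
  have P_eq: "ml_error_prob sv sw P C = (\<Sum>m<code_size C. N.prob (err m)) / real (code_size C)"
  proof -
    have "ml_decode sv sw P C (fst \<omega>) (channel_output P (fst \<omega>) (codeword C m) (snd \<omega>)) =
        ml_decode sv sw P C (fst \<omega>) (out m \<omega>)" for m \<omega>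
      using ml_decode_restrict[of sv sw P C "fst \<omega>" "channel_output P (fst \<omega>) (codeword C m) (snd \<omega>)"]
      by (simp add: out_def channel_output_def restrict_def cong: if_cong)
    then show ?thesis
      by (simp add: ml_error_prob_def Let_def err_def N_def W_def V_def)
  qed
  \<comment> \<open>The number of messages that would be decoded wrongly at \<open>\<omega>\<close>;
    as a nonnegative function it can be integrated in any order.\<close>
  define f where "f \<omega> = (\<Sum>m<code_size C. indicator (err m) \<omega> :: ennreal)" for \<omega>
  have f_meas: "f \<in> borel_measurable N" unfolding f_def by measurable
  have inner: "ennreal \<beta> \<le> (\<integral>\<^sup>+v. f (g, (w, v)) \<partial>V)" if g: "g \<in> A" and w: "w \<in> space W" for g w
  proof -
    define B where "B m = {v \<in> space V.
      ml_decode sv sw P C g (\<lambda>i\<in>{..<cw_len P}. pre_output P g (codeword C m) w i + v i) \<noteq> m}" for m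
    \<comment> \<open>The error event for fixed gains and relay noise is an iterated section of the
      joint one, hence measurable.\<close>
    have B_eq: "B m = Pair w -` Pair g -` err m" for m
      using w by (auto simp: B_def err_def out_def N_def space_pair_measure)
    have "Pair g -` err m \<in> sets (W \<Otimes>\<^sub>M V)" for m
      using err_meas unfolding N_def by (rule sets_Pair1)
    then have B_meas: "B m \<in> sets V" for m
      unfolding B_eq by (rule sets_Pair1)
    have "(\<integral>\<^sup>+v. f (g, (w, v)) \<partial>V) = (\<integral>\<^sup>+v. (\<Sum>m<code_size C. indicator (B m) v) \<partial>V)"
      by (simp add: f_def B_eq indicator_def)
    also have "\<dots> = (\<Sum>m<code_size C. ennreal (V.prob (B m)))"
      using B_meas by (subst nn_integral_sum) (auto simp: V.emeasure_eq_measure)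
    also have "\<dots> = ennreal (\<Sum>m<code_size C. V.prob (B m))" by (simp add: sum_ennreal)
    finally show ?thesis
      using le[OF g, of w] by (simp add: B_def V_def ennreal_leI)
  qed
  have "ennreal \<beta> * emeasure fading A = (\<integral>\<^sup>+g. ennreal \<beta> * indicator A g \<partial>fading)"
    using A by (simp add: nn_integral_cmult)
  also have "\<dots> \<le> (\<integral>\<^sup>+g. (\<integral>\<^sup>+w. (\<integral>\<^sup>+v. f (g, (w, v)) \<partial>V) \<partial>W) \<partial>fading)"
  proof (rule nn_integral_mono)
    fix g
    have "ennreal \<beta> \<le> (\<integral>\<^sup>+w. (\<integral>\<^sup>+v. f (g, (w, v)) \<partial>V) \<partial>W)" if "g \<in> A"
    proof -
      have "ennreal \<beta> = (\<integral>\<^sup>+w. ennreal \<beta> \<partial>W)" by (simp add: W.emeasure_space_1)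
      also have "\<dots> \<le> (\<integral>\<^sup>+w. (\<integral>\<^sup>+v. f (g, (w, v)) \<partial>V) \<partial>W)"
        by (intro nn_integral_mono inner that)
      finally show ?thesis .
    qed
    then show "ennreal \<beta> * indicator A g \<le> (\<integral>\<^sup>+w. (\<integral>\<^sup>+v. f (g, (w, v)) \<partial>V) \<partial>W)"
      by (auto simp: indicator_def)
  qed
  also have "\<dots> = (\<integral>\<^sup>+g. (\<integral>\<^sup>+p. f (g, p) \<partial>(W \<Otimes>\<^sub>M V)) \<partial>fading)"
  proof (rule nn_integral_cong)
    fix g assume "g \<in> space fading"
    then have "(\<lambda>p. f (g, p)) \<in> borel_measurable (W \<Otimes>\<^sub>M V)"
      using f_meas unfolding N_def by measurable
    then show "(\<integral>\<^sup>+w. (\<integral>\<^sup>+v. f (g, (w, v)) \<partial>V) \<partial>W) = (\<integral>\<^sup>+p. f (g, p) \<partial>(W \<Otimes>\<^sub>M V))"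
      by (rule V.nn_integral_fst)
  qed
  also have "\<dots> = (\<integral>\<^sup>+\<omega>. f \<omega> \<partial>N)"
    unfolding N_def using f_meas N_def by (intro WV.nn_integral_fst) simp
  also have "\<dots> = (\<Sum>m<code_size C. ennreal (N.prob (err m)))"
    unfolding f_def by (subst nn_integral_sum) (auto simp: N.emeasure_eq_measure)
  also have "\<dots> = ennreal (\<Sum>m<code_size C. N.prob (err m))" by (simp add: sum_ennreal)
  finally have "\<beta> * F.prob A \<le> (\<Sum>m<code_size C. N.prob (err m))"
    using \<beta> by (simp add: F.emeasure_eq_measure ennreal_mult'[symmetric] sum_nonneg)
  then show ?thesis
    unfolding P_eq by (intro divide_right_mono) (auto simp: mult.commute)
qed

subsection \<open>Quantisation of the noiseless outputs\<close>

definition grid :: "complex \<Rightarrow> int \<times> int" where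
  "grid z = (\<lfloor>Re z\<rfloor>, \<lfloor>Im z\<rfloor>)"

lemma grid_eqD:
  assumes "grid z = grid z'"
  shows "cmod (z - z') \<le> 2"
proof -
  have "\<bar>Re (z - z')\<bar> \<le> 1" "\<bar>Im (z - z')\<bar> \<le> 1"
    using assms unfolding grid_def prod.inject minus_complex.sel by linarith+
  then show ?thesis using cmod_le[of "z - z'"] by linarith
qed

lemma grid_in_box:
  assumes "cmod z \<le> T"
  shows "grid z \<in> {\<lfloor>- T\<rfloor>..\<lfloor>T\<rfloor>} \<times> {\<lfloor>- T\<rfloor>..\<lfloor>T\<rfloor>}"
  using assms abs_Re_le_cmod[of z] abs_Im_le_cmod[of z]
  by (auto simp: grid_def intro!: floor_mono)

lemma card_grid_box:
  assumes "0 \<le> T"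
  shows "real (card ({\<lfloor>- T\<rfloor>..\<lfloor>T\<rfloor>} \<times> {\<lfloor>- T\<rfloor>..\<lfloor>T\<rfloor>})) \<le> (2 * T + 2)\<^sup>2"
proof -
  have "real (card {\<lfloor>- T\<rfloor>..\<lfloor>T\<rfloor>}) = of_int (\<lfloor>T\<rfloor> - \<lfloor>- T\<rfloor> + 1)"
    using assms floor_mono[of "- T" T] by simp
  also have "\<dots> \<le> 2 * T + 2" by linarith
  finally show ?thesis
    unfolding card_cartesian_product power2_eq_square of_nat_mult
    using assms by (intro mult_mono) auto
qed

text \<open>The second group of coordinates is measured relative to a representative of the cell of the
  first group, so only its variation within such a cell enters the number of cells.\<close>

lemma two_stage_quantisation:
  fixes t u :: "'m \<Rightarrow> nat \<Rightarrow> complex"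
  assumes T: "0 \<le> T"
    and t: "\<And>m k. m \<in> S \<Longrightarrow> k < a \<Longrightarrow> cmod (t m k) \<le> T"
    and u: "\<And>m m' j. m \<in> S \<Longrightarrow> m' \<in> S \<Longrightarrow> (\<And>k. k < a \<Longrightarrow> cmod (t m k - t m' k) \<le> 2) \<Longrightarrow>
      j < b \<Longrightarrow> cmod (u m j - u m' j) \<le> T"
  obtains q :: "'m \<Rightarrow> (nat \<Rightarrow> int \<times> int) \<times> (nat \<Rightarrow> int \<times> int)"
  where "real (card (q ` S)) \<le> (2 * T + 2) ^ (2 * (a + b))"
    and "\<And>m m' k. q m = q m' \<Longrightarrow> k < a \<Longrightarrow> cmod (t m k - t m' k) \<le> 2"
    and "\<And>m m' j. q m = q m' \<Longrightarrow> j < b \<Longrightarrow> cmod (u m j - u m' j) \<le> 2"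
proof -
  define B where "B = {\<lfloor>- T\<rfloor>..\<lfloor>T\<rfloor>} \<times> {\<lfloor>- T\<rfloor>..\<lfloor>T\<rfloor>}"
  define q1 where "q1 m = (\<lambda>k\<in>{..<a}. grid (t m k))" for m
  \<comment> \<open>The representative depends on the cell only. Codewords of one first-stage cell
    are thus compared with the same point, and closeness of their offsets from it gives closeness to
    each other.\<close>
  define rep where "rep c = (SOME m. m \<in> S \<and> q1 m = c)" for c
  define q2 where "q2 m = (\<lambda>j\<in>{..<b}. grid (u m j - u (rep (q1 m)) j))" for m
  have fB: "finite B" by (simp add: B_def)
  have q1D: "cmod (t m k - t m' k) \<le> 2" if "q1 m = q1 m'" "k < a" for m m' k
    using fun_cong[OF that(1), of k] that(2) by (auto simp: q1_def intro: grid_eqD)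
  have rep: "rep (q1 m) \<in> S \<and> q1 (rep (q1 m)) = q1 m" if "m \<in> S" for m
    unfolding rep_def by (rule someI[of _ m]) (simp add: that)
  have "(\<lambda>m. (q1 m, q2 m)) ` S \<subseteq> ({..<a} \<rightarrow>\<^sub>E B) \<times> ({..<b} \<rightarrow>\<^sub>E B)"
  proof (rule image_subsetI, rule SigmaI)
    fix m assume m: "m \<in> S"
    show "q1 m \<in> {..<a} \<rightarrow>\<^sub>E B"
      using t[OF m] grid_in_box unfolding q1_def B_def by auto
    have "cmod (u m j - u (rep (q1 m)) j) \<le> T" if "j < b" for j
      using rep[OF m] q1D that m by (intro u) auto
    then show "q2 m \<in> {..<b} \<rightarrow>\<^sub>E B"
      using grid_in_box unfolding q2_def B_def by auto
  qed
  then have "card ((\<lambda>m. (q1 m, q2 m)) ` S) \<le> card (({..<a} \<rightarrow>\<^sub>E B) \<times> ({..<b} \<rightarrow>\<^sub>E B))"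
    using fB by (intro card_mono finite_cartesian_product finite_PiE) auto
  also have "\<dots> = card B ^ (a + b)"
    by (simp add: card_cartesian_product card_PiE power_add)
  finally have "real (card ((\<lambda>m. (q1 m, q2 m)) ` S)) \<le> real (card B) ^ (a + b)"
    by (simp flip: of_nat_power)
  also have "\<dots> \<le> ((2 * T + 2)\<^sup>2) ^ (a + b)"
    using card_grid_box[OF T] unfolding B_def by (intro power_mono) auto
  finally have 1: "real (card ((\<lambda>m. (q1 m, q2 m)) ` S)) \<le> (2 * T + 2) ^ (2 * (a + b))"
    by (simp only: power_mult)
  show ?thesis
  proof (rule that[OF 1])
    fix m m' k assume eq: "(q1 m, q2 m) = (q1 m', q2 m')"
    show "cmod (t m k - t m' k) \<le> 2" if "k < a" using eq q1D that by auto
    show "cmod (u m k - u m' k) \<le> 2" if "k < b"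
    proof -
      have "grid (u m k - u (rep (q1 m)) k) = grid (u m' k - u (rep (q1 m)) k)"
      proof -
        have "q2 m k = q2 m' k" "q1 m = q1 m'" using eq by auto
        then show ?thesis using that unfolding q2_def by simp
      qed
      from grid_eqD[OF this] show ?thesis by simp
    qed
  qed
qed

section \<open>Differences of noiseless outputs\<close>

text \<open>One term of the relay energy constraint, the noise term being nonnegative. It bounds the
  gain from a source symbol to a relay symbol for every \<open>h\<close>, which is why the outage
  event restricts only g1 and g2.\<close>

lemma relay_gain_le_1:
  assumes P: "af_protocol_ok E sw P" and E: "0 < E" and sw: "0 < sw"
    and j: "j < cw_len P - listen_len P" and k: "k < listen_len P"
  shows "cmod (h * relay_mat P h j k * src_diag1 P k) \<le> 1"
proof -
  let ?b = "\<lambda>i. (cmod (relay_mat P h j i))\<^sup>2" and ?a = "\<lambda>i. (cmod (src_diag1 P i))\<^sup>2"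
  have "(cmod h)\<^sup>2 * E * (?b k * ?a k) \<le> (cmod h)\<^sup>2 * E * (\<Sum>i<listen_len P. ?b i * ?a i)"
    using E k by (intro mult_left_mono member_le_sum) auto
  also have "\<dots> \<le> (cmod h)\<^sup>2 * E * (\<Sum>i<listen_len P. ?b i * ?a i) + sw * (\<Sum>i<listen_len P. ?b i)"
    using sw by (simp add: sum_nonneg)
  also have "\<dots> \<le> E" using P j by (auto simp: af_protocol_ok_def)
  finally have "(cmod (h * relay_mat P h j k * src_diag1 P k))\<^sup>2 \<le> 1\<^sup>2"
    using E by (simp add: norm_mult power_mult_distrib mult_ac)
  then show ?thesis by (rule power2_le_imp_le) simp
qed

lemma pre_output_diff_listen:
  assumes "i < listen_len P" "cmod (src_symbol P x i - src_symbol P x' i) \<le> \<delta>"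
  shows "cmod (pre_output P (g1, g2, h) x w i - pre_output P (g1, g2, h) x' w i) \<le> cmod g1 * \<delta>"
  using assms by (simp add: right_diff_distrib[symmetric] norm_mult mult_left_mono)

text \<open>The relay noise is the same for both codewords and cancels. The bound \<delta> concerns
  the symbols before multiplication by the diagonal of \<open>A\<^sub>1\<close>, since
  \<open>relay_gain_le_1\<close> already includes that factor.\<close>

lemma pre_output_diff_relay:
  assumes P: "af_protocol_ok E sw P" and E: "0 < E" and sw: "0 < sw"
    and i: "listen_len P \<le> i" "i < cw_len P"
    and \<delta>: "\<And>k. k < listen_len P \<Longrightarrow> cmod (x k - x' k) \<le> \<delta>"
    and \<delta>': "cmod (src_symbol P x i - src_symbol P x' i) \<le> \<delta>'"
  shows "cmod (pre_output P (g1, g2, h) x w i - pre_output P (g1, g2, h) x' w i) \<le>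
    cmod g2 * (real (listen_len P) * \<delta>) + cmod g1 * \<delta>'"
proof -
  let ?b = "\<lambda>k. relay_mat P h (i - listen_len P) k"
  have "h * ((\<Sum>k<listen_len P. ?b k * src_symbol P x k) - (\<Sum>k<listen_len P. ?b k * src_symbol P x' k)) =
      (\<Sum>k<listen_len P. (h * ?b k * src_diag1 P k) * (x k - x' k))"
    by (simp add: sum_subtractf[symmetric] sum_distrib_left src_symbol_def algebra_simps)
  also have "cmod \<dots> \<le> (\<Sum>k<listen_len P. \<delta>)"
  proof (rule sum_norm_le)
    fix k assume "k \<in> {..<listen_len P}"
    then have k: "k < listen_len P" by simp
    have "i - listen_len P < cw_len P - listen_len P" using i by simp
    from mult_mono[OF relay_gain_le_1[OF P E sw this k] \<delta>[OF k]]
    show "cmod (h * ?b k * src_diag1 P k * (x k - x' k)) \<le> \<delta>"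
      unfolding norm_mult[of "h * ?b k * src_diag1 P k"] by simp
  qed
  finally have 1: "cmod (h * ((\<Sum>k<listen_len P. ?b k * src_symbol P x k) -
      (\<Sum>k<listen_len P. ?b k * src_symbol P x' k))) \<le> real (listen_len P) * \<delta>" by simp
  have "pre_output P (g1, g2, h) x w i - pre_output P (g1, g2, h) x' w i =
      g2 * (h * ((\<Sum>k<listen_len P. ?b k * src_symbol P x k) - (\<Sum>k<listen_len P. ?b k * src_symbol P x' k)))
      + g1 * (src_symbol P x i - src_symbol P x' i)"
    using i by (simp add: algebra_simps)
  also have "cmod \<dots> \<le> cmod g2 * (real (listen_len P) * \<delta>) + cmod g1 * \<delta>'"
    using mult_left_mono[OF 1 norm_ge_zero[of g2]] mult_left_mono[OF \<delta>' norm_ge_zero[of g1]]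
    by (intro norm_triangle_le add_mono) (simp_all only: norm_mult)
  finally show ?thesis .
qed

text \<open>The listened symbols are resolved up to \<open>1/\<gamma>\<close>. Within such a cell the relayed outputs vary by
  \<open>O(\<gamma>)\<close> instead of \<open>O(\<gamma>\<^sup>2)\<close>, so each of the \<open>l\<close> complex coordinates costs a factor \<open>O(\<gamma>\<^sup>2)\<close>.
  A listened symbol is measured before or after the multiplication by \<open>a\<^sub>k\<close>, whichever is larger,
  to control both differences.\<close>

lemma output_cells:
  fixes x :: "'m \<Rightarrow> nat \<Rightarrow> complex"
  assumes P: "af_protocol_ok (e\<^sup>2) sw P" and e: "0 < e" and sw: "0 < sw" and v: "0 < v" and \<gamma>: "0 < \<gamma>"
    and x: "\<And>m i. m \<in> S \<Longrightarrow> i < cw_len P \<Longrightarrow> cmod (x m i) \<le> 3 * real (cw_len P) * e"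
    and sx: "\<And>m i. m \<in> S \<Longrightarrow> i < cw_len P \<Longrightarrow> cmod (src_symbol P (x m) i) \<le> 3 * real (cw_len P) * e"
    and g1: "cmod g1 * e \<le> \<gamma> * v" and g2: "cmod g2 * e \<le> \<gamma>\<^sup>2 * v"
  obtains q :: "'m \<Rightarrow> (nat \<Rightarrow> int \<times> int) \<times> (nat \<Rightarrow> int \<times> int)"
  where "real (card (q ` S)) \<le> (if \<gamma> \<le> 1 then 1 else (18 * real (cw_len P) * \<gamma>) ^ (2 * cw_len P))"
    and "\<And>m m' i. m \<in> S \<Longrightarrow> m' \<in> S \<Longrightarrow> q m = q m' \<Longrightarrow> i < cw_len P \<Longrightarrow>
      cmod (pre_output P (g1, g2, h) (x m) w i - pre_output P (g1, g2, h) (x m') w i) \<le>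
        12 * (real (cw_len P))\<^sup>2 * v"
proof -
  define l where "l = real (cw_len P)"
  define n where "n = listen_len P"
  define out where "out m i = pre_output P (g1, g2, h) (x m) w i" for m i
  have l1: "1 \<le> l" and nl: "n \<le> cw_len P" "real n \<le> l"
    using P by (auto simp: af_protocol_ok_def l_def n_def)
  have ll: "l \<le> l\<^sup>2" using l1 by (simp add: power2_eq_square)
  have dx: "cmod (x m i - x m' i) \<le> 6 * l * e" "cmod (src_symbol P (x m) i - src_symbol P (x m') i) \<le> 6 * l * e"
    if "m \<in> S" "m' \<in> S" "i < cw_len P" for m m' i
    using norm_triangle_ineq4[of "x m i" "x m' i"] x[OF that(1,3)] x[OF that(2,3)]
      norm_triangle_ineq4[of "src_symbol P (x m) i" "src_symbol P (x m') i"] sx[OF that(1,3)] sx[OF that(2,3)]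
    by (simp_all add: l_def)
  \<comment> \<open>Here \<open>d\<close> is the distance of the listened symbols in units of
    \<open>e\<close>. It is used with 6 l, the range without quantisation, and with 2 / \<gamma>,
    the resolution of the first stage.\<close>
  have relay: "cmod (out m i - out m' i) \<le> \<gamma>\<^sup>2 * v * (l * d) + 6 * l * \<gamma> * v"
    if m: "m \<in> S" "m' \<in> S" and i: "n \<le> i" "i < cw_len P" and d: "0 \<le> d"
      and near: "\<And>k. k < n \<Longrightarrow> cmod (x m k - x m' k) \<le> d * e" for m m' i d
  proof -
    have "cmod (out m i - out m' i) \<le> cmod g2 * (real n * (d * e)) + cmod g1 * (6 * l * e)"
      unfolding out_def n_def using m i near e dx
      by (intro pre_output_diff_relay[OF P _ sw]) (auto simp: n_def)
    also have "\<dots> = (cmod g2 * e) * (real n * d) + 6 * l * (cmod g1 * e)" by (simp add: algebra_simps)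
    also have "\<dots> \<le> (\<gamma>\<^sup>2 * v) * (l * d) + 6 * l * (\<gamma> * v)"
      using g1 nl l1 d e v \<gamma>
      by (intro add_mono mult_mono[OF g2] mult_mono[OF _ g1] mult_mono[OF nl(2)]) auto
    finally show ?thesis by (simp add: algebra_simps)
  qed
  show ?thesis
  proof (cases "\<gamma> \<le> 1")
    case True
    have \<gamma>2: "\<gamma>\<^sup>2 \<le> 1" using True \<gamma> by (simp add: power_le_one)
    \<comment> \<open>Weak links need no quantisation: 6 l^2 comes through the relay and at most 6
      l^2 from the direct link, so all codewords of \<open>S\<close> can share one cell.\<close>
    have near: "cmod (out m i - out m' i) \<le> 12 * l\<^sup>2 * v"
      if m: "m \<in> S" "m' \<in> S" and i: "i < cw_len P" for m m' i
    proof (cases "i < n")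
      case True': True
      have "cmod (out m i - out m' i) \<le> cmod g1 * (6 * l * e)"
        unfolding out_def using True' m i dx by (intro pre_output_diff_listen) (auto simp: n_def)
      also have "\<dots> \<le> 6 * l * (\<gamma> * v)"
        using mult_left_mono[OF g1, of "6 * l"] l1 by (simp add: mult_ac)
      also have "\<dots> \<le> 12 * l\<^sup>2 * (1 * v)"
        using True \<gamma> v ll l1 by (intro mult_mono) auto
      finally show ?thesis by simp
    next
      case False
      have "cmod (out m i - out m' i) \<le> \<gamma>\<^sup>2 * v * (l * (6 * l)) + 6 * l * \<gamma> * v"
        using False m i dx l1 nl by (intro relay) auto
      also have "\<dots> \<le> 1 * v * (l * (6 * l)) + 6 * l\<^sup>2 * 1 * v"
        using True \<gamma> \<gamma>2 v ll l1 by (intro add_mono mult_mono) auto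
      also have "\<dots> = 12 * l\<^sup>2 * v" by (simp add: power2_eq_square)
      finally show ?thesis .
    qed
    show ?thesis
    proof (rule that[of "\<lambda>_. undefined"])
      have "card ((\<lambda>_. undefined :: (nat \<Rightarrow> int \<times> int) \<times> (nat \<Rightarrow> int \<times> int)) ` S) \<le> card {undefined :: (nat \<Rightarrow> int \<times> int) \<times> (nat \<Rightarrow> int \<times> int)}"
        by (intro card_mono) auto
      then show "real (card ((\<lambda>_. undefined :: (nat \<Rightarrow> int \<times> int) \<times> (nat \<Rightarrow> int \<times> int)) ` S)) \<le>
          (if \<gamma> \<le> 1 then 1 else (18 * real (cw_len P) * \<gamma>) ^ (2 * cw_len P))"
        using True by simp
    qed (use near in \<open>auto simp: out_def l_def\<close>)
  next
    case False
    then have \<gamma>1: "1 < \<gamma>" by simp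
    \<comment> \<open>The factor \<gamma> / e turns a symbol difference of order e / \<gamma> into
      one of order 1, the mesh of the grid.\<close>
    define t where "t m k = of_real (\<gamma> / e) * (if cmod (src_diag1 P k) \<le> 1 then x m k else src_symbol P (x m) k)" for m k
    define u where "u m j = of_real (1 / v) * out m (n + j)" for m j
    have t_le: "cmod (t m k) \<le> 8 * l * \<gamma>" if "m \<in> S" "k < n" for m k
    proof -
      have "cmod (t m k) \<le> \<gamma> / e * (3 * l * e)"
        unfolding t_def norm_mult using x[of m k] sx[of m k] that nl e \<gamma>
        by (intro mult_mono) (auto simp: norm_divide l_def)
      also have "\<dots> \<le> 8 * l * \<gamma>" using e \<gamma> l1 by simp
      finally show ?thesis .
    qed
    have t_near: "cmod (x m k - x m' k) \<le> 2 / \<gamma> * e" "cmod (src_symbol P (x m) k - src_symbol P (x m') k) \<le> 2 / \<gamma> * e"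
      if k: "k < n" and d: "cmod (t m k - t m' k) \<le> 2" for m m' k
    proof -
      define c where "c = src_diag1 P k"
      have s_eq: "src_symbol P (x m) k - src_symbol P (x m') k = c * (x m k - x m' k)"
        using k by (simp add: src_symbol_def n_def c_def right_diff_distrib)
      have "t m k - t m' k = of_real (\<gamma> / e) * (if cmod c \<le> 1 then x m k - x m' k else c * (x m k - x m' k))"
        using s_eq by (cases "cmod c \<le> 1")
          (simp_all only: t_def c_def[symmetric] if_True if_False simp_thms flip: right_diff_distrib)
      then have "\<gamma> / e * cmod (if cmod c \<le> 1 then x m k - x m' k else c * (x m k - x m' k)) \<le> 2"
        using d e \<gamma> by (simp add: norm_mult norm_divide)
      then have le: "cmod (if cmod c \<le> 1 then x m k - x m' k else c * (x m k - x m' k)) \<le> 2 / \<gamma> * e"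
        using e \<gamma> by (simp add: field_simps)
      have "cmod (x m k - x m' k) \<le> 2 / \<gamma> * e \<and> cmod c * cmod (x m k - x m' k) \<le> 2 / \<gamma> * e"
      proof (cases "cmod c \<le> 1")
        case True
        then show ?thesis
          using le mult_right_mono[OF True, of "cmod (x m k - x m' k)"] by simp
      next
        case False
        then have "1 * cmod (x m k - x m' k) \<le> cmod c * cmod (x m k - x m' k)"
          by (intro mult_right_mono) auto
        with False le show ?thesis by (simp add: norm_mult)
      qed
      then show "cmod (x m k - x m' k) \<le> 2 / \<gamma> * e" "cmod (src_symbol P (x m) k - src_symbol P (x m') k) \<le> 2 / \<gamma> * e"
        unfolding s_eq norm_mult by auto
    qed
    have u_diff: "cmod (u m j - u m' j) = cmod (out m (n + j) - out m' (n + j)) / v" for m m' j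
      using v by (simp add: u_def norm_divide flip: diff_divide_distrib)
    have u_near: "cmod (u m j - u m' j) \<le> 8 * l * \<gamma>"
      if m: "m \<in> S" "m' \<in> S" and d: "\<And>k. k < n \<Longrightarrow> cmod (t m k - t m' k) \<le> 2" and j: "j < cw_len P - n" for m m' j
    proof -
      \<comment> \<open>With listened symbols known up to 2 e / \<gamma>, the relay contributes 2 l
        \<gamma> v and the direct link 6 l \<gamma> v: this is the 8 in the common radius 8 l
        \<gamma>.\<close>
      have "cmod (out m (n + j) - out m' (n + j)) \<le> \<gamma>\<^sup>2 * v * (l * (2 / \<gamma>)) + 6 * l * \<gamma> * v"
        using m d t_near j \<gamma> by (intro relay) auto
      also have "\<dots> = 8 * l * \<gamma> * v" using \<gamma> by (simp add: power2_eq_square)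
      finally show ?thesis using v by (simp add: u_diff field_simps)
    qed
    have T0: "0 \<le> 8 * l * \<gamma>" using l1 \<gamma> by simp
    obtain q :: "'m \<Rightarrow> (nat \<Rightarrow> int \<times> int) \<times> (nat \<Rightarrow> int \<times> int)" where
      q: "real (card (q ` S)) \<le> (2 * (8 * l * \<gamma>) + 2) ^ (2 * (n + (cw_len P - n)))"
      and qt: "\<And>m m' k. q m = q m' \<Longrightarrow> k < n \<Longrightarrow> cmod (t m k - t m' k) \<le> 2"
      and qu: "\<And>m m' j. q m = q m' \<Longrightarrow> j < cw_len P - n \<Longrightarrow> cmod (u m j - u m' j) \<le> 2"
      by (rule two_stage_quantisation[of "8 * l * \<gamma>" S n t "cw_len P - n" u, OF T0 t_le u_near]) simp_all
    \<comment> \<open>Since l \<gamma> \<ge> 1, the additive 2 in the cell count is absorbed: 16 + 2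
      = 18.\<close>
    have "1 * 1 \<le> l * \<gamma>" using l1 \<gamma>1 by (intro mult_mono) auto
    then have "(2 * (8 * l * \<gamma>) + 2) ^ (2 * cw_len P) \<le> (18 * l * \<gamma>) ^ (2 * cw_len P)"
      using l1 \<gamma> by (intro power_mono) (auto simp: mult.commute)
    with q nl have card: "real (card (q ` S)) \<le> (if \<gamma> \<le> 1 then 1 else (18 * real (cw_len P) * \<gamma>) ^ (2 * cw_len P))"
      using False by (simp add: l_def)
    have "1 * 1 \<le> l * l" using l1 by (intro mult_mono) auto
    then have v_le: "2 * v \<le> 12 * l\<^sup>2 * v" using v by (intro mult_right_mono) (auto simp: power2_eq_square)
    show ?thesis
    proof (rule that[OF card])
      fix m m' i assume m: "m \<in> S" "m' \<in> S" and eq: "q m = q m'" and i: "i < cw_len P"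
      have "cmod (out m i - out m' i) \<le> 2 * v"
      proof (cases "i < n")
        case True
        have "cmod (out m i - out m' i) \<le> cmod g1 * (2 / \<gamma> * e)"
          unfolding out_def using True eq by (intro pre_output_diff_listen t_near qt) (auto simp: n_def)
        also have "\<dots> = 2 / \<gamma> * (cmod g1 * e)" by simp
        also have "\<dots> \<le> 2 / \<gamma> * (\<gamma> * v)" using g1 \<gamma> by (intro mult_left_mono) auto
        finally show ?thesis using \<gamma> by simp
      next
        case False
        then have "cmod (u m (i - n) - u m' (i - n)) \<le> 2" using eq i by (intro qu) auto
        then show ?thesis using False v by (simp add: u_diff field_simps)
      qed
      from this v_le[unfolded l_def] show "cmod (pre_output P (g1, g2, h) (x m) w i - pre_output P (g1, g2, h) (x m') w i) \<le>
        12 * (real (cw_len P))\<^sup>2 * v"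
        unfolding out_def by (rule order_trans)
    qed
  qed
qed

subsection \<open>Outage\<close>

lemma markov_card:
  fixes f :: "nat \<Rightarrow> real"
  assumes f: "\<And>m. m < M \<Longrightarrow> 0 \<le> f m" and B: "(\<Sum>m<M. f m) \<le> real M * B" and K: "0 < K" "0 < B"
  shows "real (card {m\<in>{..<M}. K * B < f m}) \<le> real M / K"
proof -
  have "real (card {m\<in>{..<M}. K * B < f m}) * (K * B) = (\<Sum>m\<in>{m\<in>{..<M}. K * B < f m}. K * B)" by simp
  also have "\<dots> \<le> (\<Sum>m\<in>{m\<in>{..<M}. K * B < f m}. f m)" by (intro sum_mono) auto
  also have "\<dots> \<le> (\<Sum>m<M. f m)" using f by (intro sum_mono2) auto
  finally have "real (card {m\<in>{..<M}. K * B < f m}) * (K * B) \<le> real M * B" using B by simp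
  then show ?thesis using K by (simp add: field_simps)
qed

text \<open>Markov's inequality at 8 times the allowed mean energy of a codeword discards at most
  1/8 of the codewords for each of the two energy constraints. The energy of a symbol is at most
  that of its codeword.\<close>

lemma card_low_energy_codewords:
  assumes C: "codebook_ok E P C" and E: "0 < E" and l: "0 < cw_len P"
  defines "S \<equiv> {m\<in>{..<code_size C}. (\<forall>i<cw_len P. (cmod (codeword C m i))\<^sup>2 \<le> 8 * (real (cw_len P) * E)) \<and>
    (\<forall>i<cw_len P. (cmod (src_symbol P (codeword C m) i))\<^sup>2 \<le> 8 * (real (cw_len P) * E))}"
  shows "3 / 4 * real (code_size C) \<le> real (card S)"
proof -
  define M where "M = code_size C"
  define f where "f m = (\<Sum>i<cw_len P. (cmod (codeword C m i))\<^sup>2)" for m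
  define g where "g m = (\<Sum>i<cw_len P. (cmod (src_symbol P (codeword C m) i))\<^sup>2)" for m
  define B where "B = real (cw_len P) * E"
  have M: "2 \<le> M" and B: "0 < B" using C E l by (simp_all add: codebook_ok_def M_def B_def)
  have "(\<Sum>m<M. f m) \<le> real M * B" "(\<Sum>m<M. g m) \<le> real M * B"
    using C M l unfolding codebook_ok_def M_def[symmetric] f_def g_def B_def
    by (simp_all add: field_simps)
  moreover have nn: "0 \<le> f m" "0 \<le> g m" for m by (simp_all add: f_def g_def sum_nonneg)
  ultimately have bad: "real (card {m\<in>{..<M}. 8 * B < f m}) \<le> real M / 8" "real (card {m\<in>{..<M}. 8 * B < g m}) \<le> real M / 8"
    using markov_card[of M f B 8] markov_card[of M g B 8] nn B by auto
  have "{..<M} \<subseteq> S \<union> ({m\<in>{..<M}. 8 * B < f m} \<union> {m\<in>{..<M}. 8 * B < g m})"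
  proof
    fix m assume m: "m \<in> {..<M}"
    have "m \<in> S" if "f m \<le> 8 * B" "g m \<le> 8 * B"
    proof -
      have "(cmod (codeword C m i))\<^sup>2 \<le> f m" "(cmod (src_symbol P (codeword C m) i))\<^sup>2 \<le> g m" if "i < cw_len P" for i
        unfolding f_def g_def using that by (auto intro: member_le_sum)
      then show ?thesis
        using that m unfolding S_def M_def B_def by (auto intro: order_trans)
    qed
    then show "m \<in> S \<union> ({m\<in>{..<M}. 8 * B < f m} \<union> {m\<in>{..<M}. 8 * B < g m})"
      using m by (cases "f m \<le> 8 * B"; cases "g m \<le> 8 * B") auto
  qed
  then have "card {..<M} \<le> card (S \<union> ({m\<in>{..<M}. 8 * B < f m} \<union> {m\<in>{..<M}. 8 * B < g m}))"
    by (intro card_mono) (auto simp: S_def)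
  also have "\<dots> \<le> card S + (card {m\<in>{..<M}. 8 * B < f m} + card {m\<in>{..<M}. 8 * B < g m})"
    by (intro order_trans[OF card_Un_le] add_mono order_refl card_Un_le)
  finally have "real M \<le> real (card S) + (real (card {m\<in>{..<M}. 8 * B < f m}) + real (card {m\<in>{..<M}. 8 * B < g m}))"
    by simp
  with bad show ?thesis unfolding M_def by simp
qed

text \<open>The factor of \<open>quantised_error_ge\<close> for l coordinates and squared
  displacement (12 l^2)^2 in units of the noise variance, as supplied by
  \<open>output_cells\<close>. The final 1/4 is 3/4 for the codewords of low energy minus 1/2 for
  the cells.\<close>

definition outage_const :: "nat \<Rightarrow> real" where
  "outage_const l = (exp (- 2 * (12 * (real l)\<^sup>2)\<^sup>2) / 2) ^ l / 4"

lemma outage_const_pos: "0 < outage_const l"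
  by (simp add: outage_const_def)

text \<open>Assumption \<open>M\<close> makes the cells at most half as many as the codewords; if
  \<gamma> \<le> 1, there is at most one cell against at least two codewords.\<close>

lemma conditional_error_ge:
  assumes P: "af_protocol_ok E sw P" and C: "codebook_ok E P C"
    and E: "0 < E" and sw: "0 < sw" and sv: "0 < sv" and \<gamma>: "0 < \<gamma>"
    and g1: "(cmod g1)\<^sup>2 * E \<le> \<gamma>\<^sup>2 * sv" and g2: "(cmod g2)\<^sup>2 * E \<le> \<gamma> ^ 4 * sv"
    and M: "\<gamma> \<le> 1 \<or> 2 * (18 * real (cw_len P) * \<gamma>) ^ (2 * cw_len P) \<le> real (code_size C)"
  shows "outage_const (cw_len P) * real (code_size C) \<le> (\<Sum>m<code_size C. measure (dest_noise sv P)
      {v \<in> space (dest_noise sv P).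
         ml_decode sv sw P C (g1, g2, h) (\<lambda>i\<in>{..<cw_len P}. pre_output P (g1, g2, h) (codeword C m) w i + v i) \<noteq> m})"
    (is "_ \<le> (\<Sum>m<_. ?err m)")
proof -
  define l where "l = real (cw_len P)"
  define S where "S = {m\<in>{..<code_size C}. (\<forall>i<cw_len P. (cmod (codeword C m i))\<^sup>2 \<le> 8 * (real (cw_len P) * E)) \<and>
    (\<forall>i<cw_len P. (cmod (src_symbol P (codeword C m) i))\<^sup>2 \<le> 8 * (real (cw_len P) * E))}"
  have lpos: "0 < cw_len P" using P by (simp add: af_protocol_ok_def)
  have l1: "1 \<le> l" using lpos by (simp add: l_def)
  have cS: "3 / 4 * real (code_size C) \<le> real (card S)"
    unfolding S_def by (rule card_low_energy_codewords[OF C E lpos])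
  \<comment> \<open>As l \<ge> 1, symbol energy 8 l E gives amplitude at most 3 l sqrt E, the form
    required by \<open>output_cells\<close>.\<close>
  have "8 * l * 1 \<le> 9 * l * l" using l1 by (intro mult_mono) auto
  then have 0: "8 * (l * E) \<le> (3 * l * sqrt E)\<^sup>2"
    using E mult_right_mono[of "8 * l * 1" "9 * l * l" E]
    by (simp add: power_mult_distrib power2_eq_square[of l] mult.assoc)
  have sq: "cmod z \<le> 3 * l * sqrt E" if "(cmod z)\<^sup>2 \<le> 8 * (l * E)" for z
    using order_trans[OF that 0] l1 E by (intro power2_le_imp_le[of "cmod z"]) auto
  have P': "af_protocol_ok ((sqrt E)\<^sup>2) sw P" using P E by simp
  have 1: "cmod g1 * sqrt E \<le> \<gamma> * sqrt sv"
  proof (rule power2_le_imp_le)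
    show "(cmod g1 * sqrt E)\<^sup>2 \<le> (\<gamma> * sqrt sv)\<^sup>2"
      using g1 E sv by (simp add: power_mult_distrib)
  qed (use sv \<gamma> in simp)
  have 2: "cmod g2 * sqrt E \<le> \<gamma>\<^sup>2 * sqrt sv"
  proof (rule power2_le_imp_le)
    show "(cmod g2 * sqrt E)\<^sup>2 \<le> (\<gamma>\<^sup>2 * sqrt sv)\<^sup>2"
      using g2 E sv by (simp add: power_mult_distrib flip: power_mult)
  qed (use sv in simp)
  obtain q :: "nat \<Rightarrow> (nat \<Rightarrow> int \<times> int) \<times> (nat \<Rightarrow> int \<times> int)" where
    card_q: "real (card (q ` S)) \<le> (if \<gamma> \<le> 1 then 1 else (18 * real (cw_len P) * \<gamma>) ^ (2 * cw_len P))"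
    and near: "\<And>m m' i. m \<in> S \<Longrightarrow> m' \<in> S \<Longrightarrow> q m = q m' \<Longrightarrow> i < cw_len P \<Longrightarrow>
      cmod (pre_output P (g1, g2, h) (codeword C m) w i - pre_output P (g1, g2, h) (codeword C m') w i) \<le>
        12 * (real (cw_len P))\<^sup>2 * sqrt sv"
    by (rule output_cells[OF P' _ sw _ \<gamma> _ _ 1 2, of S "codeword C" h w])
       (use E sv sq in \<open>auto simp: S_def l_def\<close>)
  have "2 \<le> code_size C" using C by (simp add: codebook_ok_def)
  then have "real (card (q ` S)) \<le> real (code_size C) / 2"
    using M card_q by (cases "\<gamma> \<le> 1") auto
  with cS have "1 / 4 * real (code_size C) \<le> real (card S) - real (card (q ` S))" by simp
  then have "outage_const (cw_len P) * real (code_size C) \<le>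
      (exp (- 2 * (12 * (real (cw_len P))\<^sup>2)\<^sup>2) / 2) ^ card {..<cw_len P} * (real (card S) - real (card (q ` S)))"
    unfolding outage_const_def using mult_left_mono by fastforce
  also have "\<dots> \<le> (\<Sum>m\<in>S. ?err m)"
    unfolding dest_noise_def
  proof (rule quantised_error_ge[OF sv])
    show "finite S" by (simp add: S_def)
    show "ml_decode sv sw P C (g1, g2, h) \<in> Pi\<^sub>M {..<cw_len P} (\<lambda>_. borel) \<rightarrow>\<^sub>M count_space UNIV"
      using measurable_compose[OF measurable_Pair1' ml_decode_measurable[OF P sw], of "(g1, g2, h)"]
      by (simp add: space_pair_measure)
    fix m m' i assume "m \<in> S" "m' \<in> S" "q m = q m'" "i \<in> {..<cw_len P}"
    then have "(cmod (pre_output P (g1, g2, h) (codeword C m) w i - pre_output P (g1, g2, h) (codeword C m') w i))\<^sup>2 \<le>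
        (12 * (real (cw_len P))\<^sup>2 * sqrt sv)\<^sup>2"
      using near by (intro power_mono) auto
    then show "(cmod (pre_output P (g1, g2, h) (codeword C m) w i - pre_output P (g1, g2, h) (codeword C m') w i))\<^sup>2 \<le>
        (12 * (real (cw_len P))\<^sup>2)\<^sup>2 * sv"
      using sv by (simp add: power_mult_distrib)
  qed simp
  also have "\<dots> \<le> (\<Sum>m<code_size C. ?err m)"
    by (intro sum_mono2) (auto simp: S_def)
  finally show ?thesis .
qed

text \<open>The event is a rectangle with \<open>h\<close> free, so independence gives a product of
  two disc probabilities, each with a factor exp (- 1).\<close>

lemma fading_weak_gains_ge:
  assumes a: "0 \<le> a" "a \<le> 1" and b: "0 \<le> b" "b \<le> 1"
  shows "{g. (cmod (fst g))\<^sup>2 \<le> a \<and> (cmod (fst (snd g)))\<^sup>2 \<le> b} \<in> sets fading"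
    and "a * b * exp (- 2) \<le> measure fading {g. (cmod (fst g))\<^sup>2 \<le> a \<and> (cmod (fst (snd g)))\<^sup>2 \<le> b}"
proof -
  interpret G: prob_space "complex_gaussian 1" by (rule prob_space_complex_gaussian) simp
  interpret GG: prob_space "complex_gaussian 1 \<Otimes>\<^sub>M complex_gaussian 1"
    by (intro prob_space_pair G.prob_space_axioms)
  have eq: "{g :: complex \<times> complex \<times> complex. (cmod (fst g))\<^sup>2 \<le> a \<and> (cmod (fst (snd g)))\<^sup>2 \<le> b} =
      {z. (cmod z)\<^sup>2 \<le> a} \<times> ({z. (cmod z)\<^sup>2 \<le> b} \<times> UNIV)" by auto
  have m: "{z. (cmod z)\<^sup>2 \<le> t} \<in> sets (complex_gaussian 1)" for t
    by simp
  have u: "UNIV \<in> sets (complex_gaussian 1)" by simp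
  show "{g. (cmod (fst g))\<^sup>2 \<le> a \<and> (cmod (fst (snd g)))\<^sup>2 \<le> b} \<in> sets fading"
    unfolding eq fading_def using m u by (intro pair_measureI) auto
  have "measure fading {g. (cmod (fst g))\<^sup>2 \<le> a \<and> (cmod (fst (snd g)))\<^sup>2 \<le> b} =
      G.prob {z. (cmod z)\<^sup>2 \<le> a} * (G.prob {z. (cmod z)\<^sup>2 \<le> b} * G.prob UNIV)"
    unfolding eq fading_def using m u
    by (simp add: measure_def GG.emeasure_pair_measure_Times G.emeasure_pair_measure_Times pair_measureI enn2real_mult)
  also have "G.prob UNIV = 1" using G.prob_space by simp
  finally have "measure fading {g. (cmod (fst g))\<^sup>2 \<le> a \<and> (cmod (fst (snd g)))\<^sup>2 \<le> b} =
      G.prob {z. (cmod z)\<^sup>2 \<le> a} * G.prob {z. (cmod z)\<^sup>2 \<le> b}" by simp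
  moreover have "(a * exp (- 1)) * (b * exp (- 1)) \<le> G.prob {z. (cmod z)\<^sup>2 \<le> a} * G.prob {z. (cmod z)\<^sup>2 \<le> b}"
    using assms by (intro mult_mono complex_gaussian_ball_ge) auto
  moreover have "exp (- 2 :: real) = exp (- 1) * exp (- 1)" by (simp flip: exp_add)
  ultimately show "a * b * exp (- 2) \<le> measure fading {g. (cmod (fst g))\<^sup>2 \<le> a \<and> (cmod (fst (snd g)))\<^sup>2 \<le> b}"
    by (simp add: mult_ac)
qed

text \<open>On the event that the squared gains are at most \<open>a\<close> and \<open>b\<close>,
  the bounds with E / sv give the link strengths assumed in \<open>conditional_error_ge\<close>. The
  code size cancels against the average over the messages.\<close>

lemma ml_error_prob_outage_ge:
  assumes P: "af_protocol_ok E sw P" and C: "codebook_ok E P C"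
    and E: "0 < E" and sw: "0 < sw" and sv: "0 < sv" and \<gamma>: "0 < \<gamma>"
    and a: "0 \<le> a" "a \<le> 1" "a * (E / sv) \<le> \<gamma>\<^sup>2" and b: "0 \<le> b" "b \<le> 1" "b * (E / sv) \<le> \<gamma> ^ 4"
    and M: "\<gamma> \<le> 1 \<or> 2 * (18 * real (cw_len P) * \<gamma>) ^ (2 * cw_len P) \<le> real (code_size C)"
  shows "exp (- 2) * outage_const (cw_len P) * (a * b) \<le> ml_error_prob sv sw P C"
proof -
  define A where "A = {g :: complex \<times> complex \<times> complex. (cmod (fst g))\<^sup>2 \<le> a \<and> (cmod (fst (snd g)))\<^sup>2 \<le> b}"
  define \<kappa> where "\<kappa> = outage_const (cw_len P)"
  have M2: "2 \<le> code_size C" using C by (simp add: codebook_ok_def)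
  have \<kappa>: "0 < \<kappa>" unfolding \<kappa>_def by (rule outage_const_pos)
  have "measure fading A * (\<kappa> * real (code_size C)) / real (code_size C) \<le> ml_error_prob sv sw P C"
  proof (rule ml_error_prob_ge[OF P sw sv])
    show "A \<in> sets fading" unfolding A_def using a b by (intro fading_weak_gains_ge)
    show "0 \<le> \<kappa> * real (code_size C)" using \<kappa> by simp
    fix g w assume "g \<in> A"
    then obtain g1 g2 h where g: "g = (g1, g2, h)" "(cmod g1)\<^sup>2 \<le> a" "(cmod g2)\<^sup>2 \<le> b"
      by (cases g) (auto simp: A_def)
    have "(cmod g1)\<^sup>2 * E \<le> a * E" "(cmod g2)\<^sup>2 * E \<le> b * E" using g E by auto
    then have "(cmod g1)\<^sup>2 * E \<le> \<gamma>\<^sup>2 * sv" "(cmod g2)\<^sup>2 * E \<le> \<gamma> ^ 4 * sv"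
      using a(3) b(3) sv by (auto simp: field_simps)
    then show "\<kappa> * real (code_size C) \<le> (\<Sum>m<code_size C. measure (dest_noise sv P)
      {v \<in> space (dest_noise sv P).
         ml_decode sv sw P C g (\<lambda>i\<in>{..<cw_len P}. pre_output P g (codeword C m) w i + v i) \<noteq> m})"
      unfolding g(1) \<kappa>_def by (rule conditional_error_ge[OF P C E sw sv \<gamma> _ _ M])
  qed
  moreover have "a * b * exp (- 2) \<le> measure fading A"
    unfolding A_def using a b by (intro fading_weak_gains_ge)
  then have "a * b * exp (- 2) * \<kappa> \<le> measure fading A * \<kappa>" using \<kappa> by (intro mult_right_mono) auto
  ultimately show ?thesis using M2 by (simp add: \<kappa>_def mult_ac)
qed

section \<open>From error bounds to exponents\<close>

text \<open>The constant \<open>c\<close> changes the exponent by ln c / ln \<rho>, which tends to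
  0.\<close>

lemma error_exponent_le:
  fixes p :: "real \<Rightarrow> real"
  assumes c: "0 < c" and lim: "((\<lambda>\<rho>. ereal (- (ln (p \<rho>) / ln \<rho>))) \<longlongrightarrow> D) at_top"
    and ge: "eventually (\<lambda>\<rho>. c * \<rho> powr - d \<le> p \<rho>) at_top"
  shows "D \<le> ereal d"
proof (rule tendsto_le[OF _ _ lim])
  have "((\<lambda>\<rho>. d - ln c / ln \<rho>) \<longlongrightarrow> d - 0) at_top"
    by (intro tendsto_diff tendsto_const real_tendsto_divide_at_top[OF tendsto_const ln_at_top])
  then show "((\<lambda>\<rho>. ereal (d - ln c / ln \<rho>)) \<longlongrightarrow> ereal d) at_top" by simp
  show "eventually (\<lambda>\<rho>. ereal (- (ln (p \<rho>) / ln \<rho>)) \<le> ereal (d - ln c / ln \<rho>)) at_top"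
    using ge eventually_gt_at_top[of 1]
  proof eventually_elim
    case (elim \<rho>)
    have "ln (c * \<rho> powr - d) \<le> ln (p \<rho>)" using elim c by (intro ln_mono) auto
    then have "ln c - d * ln \<rho> \<le> ln (p \<rho>)" using elim c by (simp add: ln_mult ln_powr)
    then show ?case using elim by (simp add: field_simps)
  qed
qed simp

text \<open>For t strictly between s and r the code size eventually exceeds \<rho> to the power l t,
  and the surplus power l (t - s) outgrows \<open>K\<close>.\<close>

lemma code_size_eventually_ge:
  assumes mg: "has_multiplexing_gain P C r" and l: "0 < l"
    and len: "eventually (\<lambda>\<rho>. cw_len (P \<rho>) = l \<and> 2 \<le> code_size (C \<rho>)) at_top" and s: "s < r"
  shows "eventually (\<lambda>\<rho>. K * \<rho> powr (real l * s) \<le> real (code_size (C \<rho>))) at_top"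
proof -
  define t where "t = (s + r) / 2"
  have t: "s < t" "t < r" using s by (auto simp: t_def)
  have K: "eventually (\<lambda>\<rho>. K \<le> \<rho> powr (real l * (t - s))) at_top"
    \<comment> \<open>The maximum with 1 keeps the base of \<open>powr\<close> positive when
      \<open>K\<close> is not.\<close>
    using eventually_ge_at_top[of "max K 1 powr (1 / (real l * (t - s)))"]
  proof eventually_elim
    case (elim \<rho>)
    have "max K 1 = (max K 1 powr (1 / (real l * (t - s)))) powr (real l * (t - s))"
      using t l by (simp add: powr_powr)
    also have "\<dots> \<le> \<rho> powr (real l * (t - s))"
      using elim t by (intro powr_mono2) auto
    finally show ?case by simp
  qed
  have "eventually (\<lambda>\<rho>. t < code_rate (P \<rho>) (C \<rho>) / log 2 \<rho>) at_top"
    using mg t(2) unfolding has_multiplexing_gain_def by (rule order_tendstoD)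
  then show ?thesis
    using K eventually_gt_at_top[of 1] len
  proof eventually_elim
    case (elim \<rho>)
    have "0 < log 2 \<rho>" using elim by simp
    then have "real l * t * log 2 \<rho> \<le> log 2 (real (code_size (C \<rho>)))"
      using elim l by (simp add: code_rate_def field_simps)
    then have "log 2 (\<rho> powr (real l * t)) \<le> log 2 (real (code_size (C \<rho>)))"
      using elim by (simp add: log_powr)
    then have "\<rho> powr (real l * t) \<le> real (code_size (C \<rho>))"
      using elim by (subst (asm) log_le_cancel_iff) auto
    moreover have "K * \<rho> powr (real l * s) \<le> \<rho> powr (real l * (t - s)) * \<rho> powr (real l * s)"
      using elim by (intro mult_right_mono) auto
    moreover have "\<rho> powr (real l * (t - s)) * \<rho> powr (real l * s) = \<rho> powr (real l * t)"
      by (simp add: powr_add[symmetric] algebra_simps)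
    ultimately show ?case by simp
  qed
qed

text \<open>The strict inequality s < r lets the code size beat the constant 2 (18 l)^(2 l) in the
  number of cells. For r = 0 it makes s negative, hence \<gamma> \<le> 1, the case of a single
  cell.\<close>

lemma af_diversity_le:
  assumes snr: "snr_scaling E sv sw" and r: "0 \<le> r" and s: "s < r" "s \<le> 1" "r = 0 \<or> 0 < s"
    and fam: "af_family E sw P C" and mg: "has_multiplexing_gain P C r"
    and dg: "has_diversity_gain sv sw P C D"
  shows "D \<le> ereal ((1 - s) + max (1 - 2 * s) 0)"
proof -
  define d where "d = (1 - s) + max (1 - 2 * s) 0"
  from fam obtain l l' where
    fam: "\<And>\<rho>. 0 < \<rho> \<Longrightarrow> cw_len (P \<rho>) = l \<and> listen_len (P \<rho>) = l' \<and>
        af_protocol_ok (E \<rho>) (sw \<rho>) (P \<rho>) \<and> codebook_ok (E \<rho>) (P \<rho>) (C \<rho>)"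
    unfolding af_family_def by blast
  have l: "0 < l" using fam[of 1] by (auto simp: af_protocol_ok_def)
  have "eventually (\<lambda>\<rho>. cw_len (P \<rho>) = l \<and> 2 \<le> code_size (C \<rho>)) at_top"
    using eventually_gt_at_top[of "0::real"]
    by eventually_elim (use fam in \<open>auto simp: codebook_ok_def\<close>)
  from code_size_eventually_ge[OF mg l this s(1)]
  have "eventually (\<lambda>\<rho>. 2 * (18 * real l) ^ (2 * l) * \<rho> powr (real l * s) \<le> real (code_size (C \<rho>))) at_top" .
  then have "eventually (\<lambda>\<rho>. exp (- 2) * outage_const l * \<rho> powr - d \<le> ml_error_prob (sv \<rho>) (sw \<rho>) (P \<rho>) (C \<rho>)) at_top"
    using eventually_gt_at_top[of 1]
  proof eventually_elim
    case (elim \<rho>)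
    then have \<rho>: "1 < \<rho>" by simp
    \<comment> \<open>Then a \<rho> = \<rho>^s = \<gamma>^2 and b \<rho> \<le> \<rho>^(2 s) =
      \<gamma>^4, with equality for s \<le> 1/2. For larger s the cap b \<le> 1 is attained, which
      is the positive part in the bound.\<close>
    define \<gamma> where "\<gamma> = \<rho> powr (s / 2)"
    define a where "a = \<rho> powr - (1 - s)"
    define b where "b = \<rho> powr - max (1 - 2 * s) 0"
    note ok = fam[of \<rho>]
    have snr': "0 < sv \<rho>" "0 < sw \<rho>" "E \<rho> / sv \<rho> = \<rho>"
      using snr \<rho> by (auto simp: snr_scaling_def)
    then have E: "0 < E \<rho>" using \<rho> by (metis less_trans zero_less_divide_iff zero_less_one less_asym)
    have \<gamma>: "0 < \<gamma>" using \<rho> by (simp add: \<gamma>_def)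
    have \<gamma>n: "\<gamma> ^ n = \<rho> powr (real n * s / 2)" for n
      using \<rho> by (simp add: \<gamma>_def powr_realpow[symmetric] powr_powr mult.commute)
    have "a * \<rho> = \<rho> powr (- (1 - s) + 1)" using \<rho> unfolding a_def powr_add by simp
    then have a: "a * (E \<rho> / sv \<rho>) \<le> \<gamma>\<^sup>2" unfolding snr' \<gamma>n by simp
    have "b * \<rho> = \<rho> powr (- max (1 - 2 * s) 0 + 1)" using \<rho> unfolding b_def powr_add by simp
    also have "\<dots> \<le> \<rho> powr (2 * s)" using \<rho> by (intro powr_mono) auto
    finally have b: "b * (E \<rho> / sv \<rho>) \<le> \<gamma> ^ 4" unfolding snr' \<gamma>n by simp
    have M: "\<gamma> \<le> 1 \<or> 2 * (18 * real (cw_len (P \<rho>)) * \<gamma>) ^ (2 * cw_len (P \<rho>)) \<le> real (code_size (C \<rho>))"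
    proof (cases "r = 0")
      case True
      then show ?thesis using s \<rho> powr_mono[of "s / 2" 0 \<rho>] by (simp add: \<gamma>_def)
    next
      case False
      \<comment> \<open>Two real dimensions for each of l symbols: \<gamma>^(2 l) = \<rho>^(l s),
        the power reached by the code size.\<close>
      have "(18 * real l * \<gamma>) ^ (2 * l) = (18 * real l) ^ (2 * l) * \<rho> powr (real l * s)"
        unfolding power_mult_distrib[of _ \<gamma>] \<gamma>n by simp
      then show ?thesis using elim ok \<rho> by (simp add: mult.assoc)
    qed
    have "a \<le> 1" "b \<le> 1"
      using s \<rho> powr_mono[of "- (1 - s)" 0 \<rho>] powr_mono[of "- max (1 - 2 * s) 0" 0 \<rho>]
      by (auto simp: a_def b_def)
    then have "exp (- 2) * outage_const (cw_len (P \<rho>)) * (a * b) \<le> ml_error_prob (sv \<rho>) (sw \<rho>) (P \<rho>) (C \<rho>)"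
      using ok \<rho> by (intro ml_error_prob_outage_ge[OF _ _ E snr'(2,1) \<gamma> _ _ a _ _ b M]) (auto simp: a_def b_def)
    moreover have "a * b = \<rho> powr - d"
      unfolding a_def b_def d_def by (simp flip: powr_add)
    ultimately show ?case using ok \<rho> by simp
  qed
  then show ?thesis
    unfolding d_def[symmetric] using dg outage_const_pos[of l]
    by (intro error_exponent_le[where c = "exp (- 2) * outage_const l"]) (auto simp: has_diversity_gain_def)
qed

theorem theorem1:
  fixes E sv sw :: "real \<Rightarrow> real" and r :: real
  assumes "snr_scaling E sv sw"
    and "0 \<le> r" and "r \<le> 1"
  shows "optimal_diversity E sv sw r \<le> ereal ((1 - r) + max (1 - 2 * r) 0)"
  unfolding optimal_diversity_def
proof (rule Sup_least, clarify)
  fix D P C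
  assume fam: "af_family E sw P C" "has_multiplexing_gain P C r" "has_diversity_gain sv sw P C D"
  show "D \<le> ereal ((1 - r) + max (1 - 2 * r) 0)"
  \<comment> \<open>The bound is continuous in s, so s may tend to r from the left.\<close>
  proof (rule tendsto_lowerbound)
    have "((\<lambda>s. (1 - s) + max (1 - 2 * s) 0) \<longlongrightarrow> (1 - r) + max (1 - 2 * r) 0) (at_left r)"
      by (intro tendsto_intros)
    then show "((\<lambda>s. ereal ((1 - s) + max (1 - 2 * s) 0)) \<longlongrightarrow> ereal ((1 - r) + max (1 - 2 * r) 0)) (at_left r)"
      by simp
    \<comment> \<open>The left end of the interval is chosen to meet the condition
      \<open>r = 0 \<or> 0 < s\<close> of \<open>af_diversity_le\<close>.\<close>
    have "eventually (\<lambda>s. s \<in> {if r = 0 then - 1 else 0<..<r}) (at_left r)"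
      using assms by (intro eventually_at_left_real) auto
    then show "eventually (\<lambda>s. D \<le> ereal ((1 - s) + max (1 - 2 * s) 0)) (at_left r)"
    proof eventually_elim
      case (elim s)
      then show ?case
        using assms by (intro af_diversity_le[OF assms(1,2) _ _ _ fam]) (auto split: if_splits)
    qed
  qed simp
qed

end
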